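(* Let $(z_n)_{n\in\mathbb N}$ be the sequence defined in the context. There exist $A>0$ and $C>0$ such that, for every $n$, $$\Big\|z_n(t,\cdot)-\frac1{|\Omega|}\Big\|^2_{L^2(\Omega)}\le Ce^{-At}$$ for $t$ large enough.
   Context: $\Omega\subset\mathbb R^N$ is a bounded domain. Each kernel $V\in\{J,G,R\}$ is a function $V:\mathbb R^N\times\mathbb R^N\to\mathbb R$ that is continuous, non-negative, symmetric ($V(x,y)=V(y,x)$), satisfies $V(x,x)>0$ for every $x$, and $\int_{\mathbb R^N}V(x,y)\,dy=1$ for every $x$. For each $n$, $\overline\Omega=A_n\cup B_n$ with $A_n\cap B_n=\emptyset$, $B_n$ open with Lipschitz boundary (so $|\partial A_n\cap\Omega|=|\partial B_n\cap\Omega|=0$). It is assumed that $\chi_{A_n}\rightharpoonup X$ and $\chi_{B_n}\rightharpoonup 1-X$ weakly in $L^\infty(\overline\Omega)$ (i.e. tested against $L^1$ functions), with $0<X(x)<1$. Fix $\bar x\in\Omega$. It is assumed that, for every $n$, $$\chi_{A_n}(\bar x)\int_\Omega\chi_{A_n}(y)J(\bar x,y)dy+\chi_{B_n}(\bar x)\int_\Omega\chi_{B_n}(y)G(\bar x,y)dy+\chi_{A_n}(\bar x)\int_\Omega\chi_{B_n}(y)R(\bar x,y)dy+\chi_{B_n}(\bar x)\int_\Omega\chi_{A_n}(y)R(\bar x,y)dy=1.$$ $z_n(t,x)$ is the solution, with $z_n(t,\cdot)\in L^2(\Omega)$ and $z_n(0,x)=0$, of $$\begin{aligned} \frac{\partial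 z_n}{\partial t}(t,x)=&\chi_{A_n}(x)\int_\Omega\chi_{A_n}(y)J(x,y)(z_n(t,y)-z_n(t,x))dy+e^{-t}\chi_{A_n}(\bar x)\chi_{A_n}(x)J(\bar x,x)\\ &+\chi_{B_n}(x)\int_\Omega\chi_{B_n}(y)G(x,y)(z_n(t,y)-z_n(t,x))dy+e^{-t}\chi_{B_n}(\bar x)\chi_{B_n}(x)G(\bar x,x)\\ &+\chi_{A_n}(x)\int_\Omega\chi_{B_n}(y)R(x,y)(z_n(t,y)-z_n(t,x))dy+e^{-t}\chi_{A_n}(\bar x)\chi_{B_n}(x)R(\bar x,x)\\ &+\chi_{B_n}(x)\int_\Omega\chi_{A_n}(y)R(x,y)(z_n(t,y)-z_n(t,x))dy+e^{-t}\chi_{B_n}(\bar x)\chi_{A_n}(x)R(\bar x,x). \end{aligned}$$ *)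

theory Defs
  imports "HOL-Analysis.Analysis"
begin

definition admissible_kernel :: "('a::euclidean_space \<Rightarrow> 'a \<Rightarrow> real) \<Rightarrow> bool" where
  "admissible_kernel V \<longleftrightarrow>
     continuous_on UNIV (\<lambda>(x, y). V x y) \<and>
     (\<forall>x y. 0 \<le> V x y) \<and>
     (\<forall>x y. V x y = V y x) \<and>
     (\<forall>x. 0 < V x x) \<and>
     (\<forall>x. has_bochner_integral lebesgue (V x) 1)"

text \<open>
  Near each boundary point the set is, in suitable orthogonal coordinates, the strict epigraph of a
  Lipschitz function: the unit vector \<open>e\<close> is the vertical direction, and the hyperplane
  orthogonal to \<open>e\<close> plays the role of the space of the remaining coordinates.
\<close>

definition lipschitz_boundary :: "'a::euclidean_space set \<Rightarrow> bool" where
  "lipschitz_boundary S \<longleftrightarrow>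
     (\<forall>p \<in> frontier S. \<exists>e r L. \<exists>g :: 'a \<Rightarrow> real.
        norm e = 1 \<and> 0 < r \<and> L-lipschitz_on {y. y \<bullet> e = 0} g \<and>
        S \<inter> ball p r = {x \<in> ball p r. g (x - (x \<bullet> e) *\<^sub>R e) < x \<bullet> e})"

definition Linfty :: "'a::euclidean_space set \<Rightarrow> ('a \<Rightarrow> real) set" where
  "Linfty S = {f. f \<in> borel_measurable (lebesgue_on S) \<and>
                  (\<exists>M. AE x in lebesgue_on S. \<bar>f x\<bar> \<le> M)}"

definition weak_Linfty_limit ::
  "'a::euclidean_space set \<Rightarrow> (nat \<Rightarrow> 'a \<Rightarrow> real) \<Rightarrow> ('a \<Rightarrow> real) \<Rightarrow> bool" where
  "weak_Linfty_limit S f g \<longleftrightarrow>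
     (\<forall>n. f n \<in> Linfty S) \<and> g \<in> Linfty S \<and>
     (\<forall>\<phi> :: 'a \<Rightarrow> real. integrable (lebesgue_on S) \<phi> \<longrightarrow>
        (\<lambda>n. \<integral>x. f n x * \<phi> x \<partial>lebesgue_on S) \<longlonglongrightarrow> (\<integral>x. g x * \<phi> x \<partial>lebesgue_on S))"

definition L2 :: "'a::euclidean_space set \<Rightarrow> ('a \<Rightarrow> real) set" where
  "L2 S = {f. f \<in> borel_measurable (lebesgue_on S) \<and> integrable (lebesgue_on S) (\<lambda>x. (f x)\<^sup>2)}"

definition L2_norm :: "'a::euclidean_space set \<Rightarrow> ('a \<Rightarrow> real) \<Rightarrow> real" where
  "L2_norm S f = sqrt (\<integral>x. (f x)\<^sup>2 \<partial>lebesgue_on S)"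

text \<open>
  Derivative, as an \<open>L2\<close>-valued function, of \<open>u\<close> at time \<open>t\<close>; it is one-sided at \<open>t = 0\<close>,
  and \<open>u s\<close> is irrelevant for \<open>s < 0\<close>.
\<close>

definition has_L2_time_derivative ::
  "'a::euclidean_space set \<Rightarrow> (real \<Rightarrow> 'a \<Rightarrow> real) \<Rightarrow> ('a \<Rightarrow> real) \<Rightarrow> real \<Rightarrow> bool" where
  "has_L2_time_derivative S u D t \<longleftrightarrow>
     D \<in> L2 S \<and>
     ((\<lambda>s. L2_norm S (\<lambda>x. (u s x - u t x) / (s - t) - D x)) \<longlongrightarrow> 0) (at t within {0..})"

definition evolution_rhs ::
  "'a::euclidean_space set \<Rightarrow> 'a set \<Rightarrow> 'a set \<Rightarrow>
   ('a \<Rightarrow> 'a \<Rightarrow> real) \<Rightarrow> ('a \<Rightarrow> 'a \<Rightarrow> real) \<Rightarrow> ('a \<Rightarrow> 'a \<Rightarrow> real) \<Rightarrow>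
   'a \<Rightarrow> (real \<Rightarrow> 'a \<Rightarrow> real) \<Rightarrow> real \<Rightarrow> 'a \<Rightarrow> real" where
  "evolution_rhs \<Omega> A B J G R xbar z t x =
     indicat_real A x * (\<integral>y. indicat_real A y * J x y * (z t y - z t x) \<partial>lebesgue_on \<Omega>)
       + exp (- t) * indicat_real A xbar * indicat_real A x * J xbar x
   + indicat_real B x * (\<integral>y. indicat_real B y * G x y * (z t y - z t x) \<partial>lebesgue_on \<Omega>)
       + exp (- t) * indicat_real B xbar * indicat_real B x * G xbar x
   + indicat_real A x * (\<integral>y. indicat_real B y * R x y * (z t y - z t x) \<partial>lebesgue_on \<Omega>)
       + exp (- t) * indicat_real A xbar * indicat_real B x * R xbar x
   + indicat_real B x * (\<integral>y. indicat_real A y * R x y * (z t y - z t x) \<partial>lebesgue_on \<Omega>)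
       + exp (- t) * indicat_real B xbar * indicat_real A x * R xbar x"

text \<open>
  Functions in \<open>L2\<close> are only determined almost everywhere, so the initial condition is an
  almost-everywhere statement and the equation is an identity in \<open>L2\<close> for every \<open>t \<ge> 0\<close>.
\<close>

definition evolution_solution ::
  "'a::euclidean_space set \<Rightarrow> 'a set \<Rightarrow> 'a set \<Rightarrow>
   ('a \<Rightarrow> 'a \<Rightarrow> real) \<Rightarrow> ('a \<Rightarrow> 'a \<Rightarrow> real) \<Rightarrow> ('a \<Rightarrow> 'a \<Rightarrow> real) \<Rightarrow>
   'a \<Rightarrow> (real \<Rightarrow> 'a \<Rightarrow> real) \<Rightarrow> bool" where
  "evolution_solution \<Omega> A B J G R xbar z \<longleftrightarrow>
     (\<forall>t\<ge>0. z t \<in> L2 \<Omega>) \<and>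
     (AE x in lebesgue_on \<Omega>. z 0 x = 0) \<and>
     (\<forall>t\<ge>0. has_L2_time_derivative \<Omega> z (evolution_rhs \<Omega> A B J G R xbar z t) t)"

end

theory Submission
  imports Defs
begin

text \<open>
  For each \<open>n\<close> the four integral terms of the equation combine into one symmetric kernel
  \<open>K\<^sub>n\<close>, equal to \<open>J\<close> on \<open>A\<^sub>n \<times> A\<^sub>n\<close>, to \<open>G\<close> on
  \<open>B\<^sub>n \<times> B\<^sub>n\<close> and to \<open>R\<close> on the two mixed blocks
  (\<open>coupled_kernel\<close>), and the four source terms combine into
  \<open>e\<^sup>-\<^sup>t K\<^sub>n(xbar, x)\<close>, where \<open>K\<^sub>n(xbar, \<cdot>)\<close> has integral 1.  The proof is
  an energy estimate for this single linear equation.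

  The constants do not depend on \<open>n\<close> because every value of \<open>K\<^sub>n\<close> is a value of
  \<open>J\<close>, \<open>G\<close> or \<open>R\<close>.  These are continuous and positive on the diagonal, so by compactness
  of the closure of \<open>\<Omega>\<close> there are \<open>c, \<delta> > 0\<close> with \<open>K\<^sub>n(x, y) \<ge> c\<close>
  whenever \<open>|x - y| < \<delta>\<close>, whatever the partition is.  Hence the quadratic form
  \<open>\<integral>\<integral> K\<^sub>n(x, y) (u(x) - u(y))\<^sup>2\<close> dominates \<open>c\<close> times the form with the fixed kernel
  \<open>1\<close> on \<open>|x - y| < \<delta>\<close>.  For the latter a Poincare inequality holds on every bounded
  connected open set (\<open>nonlocal_Poincare\<close>): the relation ``the square differences of \<open>u\<close> between
  the balls around two points are controlled by the form'' is an equivalence relation that contains all pairs of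
  close points, so connectedness makes it hold for all pairs, and finitely many balls cover \<open>\<Omega>\<close>.

  Write \<open>m = |\<Omega>|\<close> and \<open>w = z - 1/m\<close>.  Symmetry of the kernel makes the integral operator conserve
  mass, so \<open>\<integral> z = 1 - e\<^sup>-\<^sup>t\<close> and \<open>\<integral> w = - e\<^sup>-\<^sup>t\<close>.  It also gives
  \<open>d/dt \<integral> w\<^sup>2 = - \<integral>\<integral> K\<^sub>n(x, y) (w(x) - w(y))\<^sup>2 + 2 e\<^sup>-\<^sup>t \<integral> K\<^sub>n(xbar, x) w(x)\<close>.
  The Poincare inequality bounds the first term by \<open>- 2 \<mu> (\<integral> w\<^sup>2 - e\<^sup>-\<^sup>2\<^sup>t / m)\<close>, and half of
  this damping absorbs the \<open>w\<close> in the source term at the cost of a further multiple of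
  \<open>e\<^sup>-\<^sup>2\<^sup>t\<close>.  The resulting differential inequality integrates to exponential
  decay with rate \<open>min \<mu> 1\<close> (\<open>nonlocal_evolution_decay\<close>).
\<close>

section \<open>Square-integrable functions\<close>

text \<open>
  The quadratic forms below make sense over any finite measure; this is the matching form of
  \<open>L2\<close>, which is tied to Lebesgue measure.
\<close>

definition square_integrable :: "'a measure \<Rightarrow> ('a \<Rightarrow> real) \<Rightarrow> bool" where
  "square_integrable M u \<longleftrightarrow> u \<in> borel_measurable M \<and> integrable M (\<lambda>x. (u x)\<^sup>2)"

lemma square_integrable_measurable[measurable_dest]:
  "square_integrable M u \<Longrightarrow> u \<in> borel_measurable M"
  by (simp add: square_integrable_def)

lemma integrable_mult_square_integrable:
  assumes "square_integrable M u" "square_integrable M v"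
  shows "integrable M (\<lambda>x. u x * v x)"
proof (rule Bochner_Integration.integrable_bound)
  show "integrable M (\<lambda>x. (u x)\<^sup>2 + (v x)\<^sup>2)"
    using assms by (auto simp: square_integrable_def)
  show "(\<lambda>x. u x * v x) \<in> borel_measurable M"
    using assms by measurable
  have "\<bar>u x * v x\<bar> \<le> (u x)\<^sup>2 + (v x)\<^sup>2" for x
  proof -
    have "0 \<le> (\<bar>u x\<bar> - \<bar>v x\<bar>)\<^sup>2 + (u x)\<^sup>2 + (v x)\<^sup>2" by simp
    then show ?thesis by (simp add: power2_diff abs_mult)
  qed
  then show "AE x in M. norm (u x * v x) \<le> norm ((u x)\<^sup>2 + (v x)\<^sup>2)"
    by simp
qed

lemma square_integrable_add:
  assumes "square_integrable M u" "square_integrable M v"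
  shows "square_integrable M (\<lambda>x. u x + v x)"
proof -
  have "integrable M (\<lambda>x. (u x)\<^sup>2 + (v x)\<^sup>2 + 2 * (u x * v x))"
    using assms integrable_mult_square_integrable[OF assms]
    by (auto simp: square_integrable_def)
  then have "integrable M (\<lambda>x. (u x + v x)\<^sup>2)"
    by (simp add: power2_sum mult.assoc)
  then show ?thesis
    using assms unfolding square_integrable_def by auto
qed

lemma square_integrable_cmult:
  "square_integrable M u \<Longrightarrow> square_integrable M (\<lambda>x. c * u x)"
  by (auto simp: square_integrable_def power_mult_distrib)

lemma square_integrable_diff:
  assumes "square_integrable M u" "square_integrable M v"
  shows "square_integrable M (\<lambda>x. u x - v x)"
  using square_integrable_add[OF assms(1) square_integrable_cmult[OF assms(2), of "-1"]] by simp

text \<open>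
  The polynomial \<open>r \<mapsto> \<integral> (u + r v)\<^sup>2\<close> is nonnegative; its minimum is at \<open>r = - b / c\<close>, and when its
  leading coefficient \<open>c\<close> vanishes so does the linear one.
\<close>

lemma Cauchy_Schwarz_integral:
  assumes u: "square_integrable M u" and v: "square_integrable M v"
  shows "(\<integral>x. u x * v x \<partial>M)\<^sup>2 \<le> (\<integral>x. (u x)\<^sup>2 \<partial>M) * (\<integral>x. (v x)\<^sup>2 \<partial>M)"
proof -
  define a where "a = (\<integral>x. (u x)\<^sup>2 \<partial>M)"
  define b where "b = (\<integral>x. u x * v x \<partial>M)"
  define c where "c = (\<integral>x. (v x)\<^sup>2 \<partial>M)"
  have uu: "integrable M (\<lambda>x. (u x)\<^sup>2)" and vv: "integrable M (\<lambda>x. (v x)\<^sup>2)"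
    and uv: "integrable M (\<lambda>x. u x * v x)"
    using u v integrable_mult_square_integrable[OF u v] by (auto simp: square_integrable_def)
  have quad: "0 \<le> a + 2 * r * b + r\<^sup>2 * c" for r
  proof -
    have "0 \<le> (\<integral>x. (u x + r * v x)\<^sup>2 \<partial>M)" by simp
    also have "\<dots> = (\<integral>x. (u x)\<^sup>2 + 2 * r * (u x * v x) + r\<^sup>2 * (v x)\<^sup>2 \<partial>M)"
      by (intro Bochner_Integration.integral_cong) (auto simp: power2_eq_square algebra_simps)
    also have "\<dots> = a + 2 * r * b + r\<^sup>2 * c"
      using uu vv uv by (simp add: a_def b_def c_def)
    finally show ?thesis .
  qed
  have "c \<ge> 0" by (simp add: c_def)
  have "b\<^sup>2 \<le> a * c"
  proof (cases "c = 0")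
    case True
    have "b = 0"
    proof (rule ccontr)
      assume "b \<noteq> 0"
      with quad[of "- (a + 1) / (2 * b)"] True show False by (simp add: field_simps)
    qed
    with True show ?thesis by simp
  next
    case False
    with \<open>c \<ge> 0\<close> have "c > 0" by simp
    have "0 \<le> (a + 2 * (- b / c) * b + (- b / c)\<^sup>2 * c) * c"
      using quad[of "- b / c"] \<open>c > 0\<close> by simp
    also have "\<dots> = a * c - b\<^sup>2"
      using \<open>c > 0\<close> by (simp add: field_simps power2_eq_square)
    finally show ?thesis by simp
  qed
  then show ?thesis by (simp add: a_def b_def c_def)
qed

context finite_measure
begin

lemma square_integrable_const: "square_integrable M (\<lambda>x. c)"
  by (simp add: square_integrable_def)

lemma square_integrable_imp_integrable:
  "square_integrable M u \<Longrightarrow> integrable M u"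
  using integrable_mult_square_integrable[OF _ square_integrable_const, of u 1] by simp

end

section \<open>Nonlocal Dirichlet forms\<close>

text \<open>
  The bound is asked for on the space of \<open>M\<close> only, since continuous kernels are bounded on bounded
  sets but not globally.
\<close>

definition bounded_kernel :: "'a measure \<Rightarrow> ('a \<Rightarrow> 'a \<Rightarrow> real) \<Rightarrow> bool" where
  "bounded_kernel M K \<longleftrightarrow>
     (\<lambda>(x, y). K x y) \<in> borel_measurable (M \<Otimes>\<^sub>M M) \<and>
     (\<exists>b. \<forall>x \<in> space M. \<forall>y \<in> space M. \<bar>K x y\<bar> \<le> b)"

definition dirichlet_form :: "'a measure \<Rightarrow> ('a \<Rightarrow> 'a \<Rightarrow> real) \<Rightarrow> ('a \<Rightarrow> real) \<Rightarrow> real" where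
  "dirichlet_form M K u = (\<integral>(x, y). K x y * (u x - u y)\<^sup>2 \<partial>(M \<Otimes>\<^sub>M M))"

lemma integrable_kernel_row:
  assumes K: "bounded_kernel M K" and x: "x \<in> space M" and f: "integrable M f"
  shows "integrable M (\<lambda>y. K x y * f y)"
proof -
  have "(\<lambda>(x, y). K x y) \<in> borel_measurable (M \<Otimes>\<^sub>M M)"
    using K by (simp add: bounded_kernel_def)
  from measurable_Pair2[OF this x] have [measurable]: "K x \<in> borel_measurable M" by simp
  note [measurable] = borel_measurable_integrable[OF f]
  obtain b where b: "\<And>y. y \<in> space M \<Longrightarrow> \<bar>K x y\<bar> \<le> b"
    using K x by (auto simp: bounded_kernel_def)
  show ?thesis
  proof (rule Bochner_Integration.integrable_bound)
    show "integrable M (\<lambda>y. b * f y)" using f by simp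
    show "AE y in M. norm (K x y * f y) \<le> norm (b * f y)"
      using b by (intro AE_I2) (force simp: abs_mult intro!: mult_right_mono)
  qed measurable
qed

lemma bounded_kernel_add:
  assumes "bounded_kernel M K" "bounded_kernel M L"
  shows "bounded_kernel M (\<lambda>x y. K x y + L x y)"
proof -
  obtain b c where b: "\<And>x y. x \<in> space M \<Longrightarrow> y \<in> space M \<Longrightarrow> \<bar>K x y\<bar> \<le> b"
    and c: "\<And>x y. x \<in> space M \<Longrightarrow> y \<in> space M \<Longrightarrow> \<bar>L x y\<bar> \<le> c"
    and [measurable]: "(\<lambda>(x, y). K x y) \<in> borel_measurable (M \<Otimes>\<^sub>M M)"
      "(\<lambda>(x, y). L x y) \<in> borel_measurable (M \<Otimes>\<^sub>M M)"
    using assms unfolding bounded_kernel_def by metis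
  have "\<bar>K x y + L x y\<bar> \<le> b + c" if "x \<in> space M" "y \<in> space M" for x y
    using b[OF that] c[OF that] by linarith
  moreover have "(\<lambda>(x, y). K x y + L x y) \<in> borel_measurable (M \<Otimes>\<^sub>M M)" by measurable
  ultimately show ?thesis unfolding bounded_kernel_def by (intro conjI exI ballI) auto
qed

lemma bounded_kernel_mult:
  assumes "bounded_kernel M K" "bounded_kernel M L"
  shows "bounded_kernel M (\<lambda>x y. K x y * L x y)"
proof -
  obtain b c where b: "\<And>x y. x \<in> space M \<Longrightarrow> y \<in> space M \<Longrightarrow> \<bar>K x y\<bar> \<le> b"
    and c: "\<And>x y. x \<in> space M \<Longrightarrow> y \<in> space M \<Longrightarrow> \<bar>L x y\<bar> \<le> c"
    and [measurable]: "(\<lambda>(x, y). K x y) \<in> borel_measurable (M \<Otimes>\<^sub>M M)"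
      "(\<lambda>(x, y). L x y) \<in> borel_measurable (M \<Otimes>\<^sub>M M)"
    using assms unfolding bounded_kernel_def by metis
  have "\<bar>K x y * L x y\<bar> \<le> b * c" if "x \<in> space M" "y \<in> space M" for x y
    unfolding abs_mult using b[OF that] c[OF that] by (intro mult_mono) auto
  moreover have "(\<lambda>(x, y). K x y * L x y) \<in> borel_measurable (M \<Otimes>\<^sub>M M)" by measurable
  ultimately show ?thesis unfolding bounded_kernel_def by (intro conjI exI ballI) auto
qed

lemma bounded_kernel_blocks:
  assumes [measurable]: "D \<in> sets M" "E \<in> sets M"
  shows "bounded_kernel M (\<lambda>x y. indicat_real D x * indicat_real E y)"
  unfolding bounded_kernel_def
  by (intro conjI exI[of _ 1]) (measurable, auto simp: indicator_def)

lemma bounded_kernel_cong: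
  assumes "\<And>x y. x \<in> space M \<Longrightarrow> y \<in> space M \<Longrightarrow> K x y = L x y" and K: "bounded_kernel M K"
  shows "bounded_kernel M L"
proof -
  have "(\<lambda>(x, y). K x y) \<in> borel_measurable (M \<Otimes>\<^sub>M M) \<longleftrightarrow> (\<lambda>(x, y). L x y) \<in> borel_measurable (M \<Otimes>\<^sub>M M)"
    by (rule measurable_cong) (use assms(1) in \<open>auto simp: space_pair_measure\<close>)
  then show ?thesis
    using K assms(1) unfolding bounded_kernel_def by simp
qed

text \<open>
  Measurability is asked for the traces of \<open>D\<close> and \<open>E\<close> on the space because the pieces of a
  partition of the closure of \<open>\<Omega>\<close> stick out of \<open>\<Omega>\<close>.
\<close>

lemma bounded_kernel_restrict:
  assumes "bounded_kernel M V" and "{x \<in> space M. x \<in> D} \<in> sets M" "{x \<in> space M. x \<in> E} \<in> sets M"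
  shows "bounded_kernel M (\<lambda>x y. indicat_real D x * indicat_real E y * V x y)"
proof (rule bounded_kernel_cong)
  show "bounded_kernel M (\<lambda>x y. indicat_real {x \<in> space M. x \<in> D} x
      * indicat_real {x \<in> space M. x \<in> E} y * V x y)"
    by (intro bounded_kernel_mult bounded_kernel_blocks assms)
qed (simp add: indicator_def)

lemma continuous_kernel_measurable:
  fixes V :: "'a::euclidean_space \<Rightarrow> 'a \<Rightarrow> real"
  assumes "continuous_on UNIV (\<lambda>(x, y). V x y)"
  shows "(\<lambda>(x, y). V x y) \<in> borel_measurable (lebesgue_on S \<Otimes>\<^sub>M lebesgue_on S)"
proof -
  let ?M = "lebesgue_on S"
  have id: "(\<lambda>x. x) \<in> ?M \<rightarrow>\<^sub>M borel"
    using id_borel_measurable_lebesgue_on[of S] by (simp add: id_def)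
  have "(\<lambda>p. (fst p, snd p)) \<in> ?M \<Otimes>\<^sub>M ?M \<rightarrow>\<^sub>M borel \<Otimes>\<^sub>M borel"
    by (intro measurable_Pair measurable_compose[OF measurable_fst id]
        measurable_compose[OF measurable_snd id])
  moreover have "(\<lambda>(x, y). V x y) \<in> borel_measurable (borel \<Otimes>\<^sub>M borel)"
    unfolding borel_prod using assms by (rule borel_measurable_continuous_onI)
  ultimately show ?thesis
    using measurable_compose by (fastforce simp: split_def)
qed

context finite_measure
begin

interpretation P: pair_sigma_finite M M ..

lemma integrable_kernel_mult:
  assumes K: "bounded_kernel M K" and f: "integrable M f" and g: "integrable M g"
  shows "integrable (M \<Otimes>\<^sub>M M) (\<lambda>(x, y). K x y * (f x * g y))"
proof -
  have [measurable]: "(\<lambda>(x, y). K x y) \<in> borel_measurable (M \<Otimes>\<^sub>M M)"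
    using K by (simp add: bounded_kernel_def)
  note [measurable] = borel_measurable_integrable[OF f] borel_measurable_integrable[OF g]
  obtain b where b: "\<And>x y. x \<in> space M \<Longrightarrow> y \<in> space M \<Longrightarrow> \<bar>K x y\<bar> \<le> b"
    using K by (auto simp: bounded_kernel_def)
  have fg: "integrable (M \<Otimes>\<^sub>M M) (\<lambda>(x, y). f x * g y)"
  proof (rule P.Fubini_integrable)
    show "integrable M (\<lambda>x. \<integral>y. norm (case (x, y) of (x, y) \<Rightarrow> f x * g y) \<partial>M)"
      using f by (simp add: abs_mult)
  qed (use g in auto)
  show ?thesis
  proof (rule Bochner_Integration.integrable_bound)
    show "integrable (M \<Otimes>\<^sub>M M) (\<lambda>p. b * (case p of (x, y) \<Rightarrow> f x * g y))"
      using fg by simp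
    show "(\<lambda>(x, y). K x y * (f x * g y)) \<in> borel_measurable (M \<Otimes>\<^sub>M M)"
      by measurable
    have "\<bar>K x y * (f x * g y)\<bar> \<le> \<bar>b * (f x * g y)\<bar>"
      if "x \<in> space M" "y \<in> space M" for x y
      using mult_right_mono[OF b[OF that], of "\<bar>f x * g y\<bar>"] b[OF that]
      by (simp add: abs_mult)
    then show "AE p in M \<Otimes>\<^sub>M M. norm (case p of (x, y) \<Rightarrow> K x y * (f x * g y))
                 \<le> norm (b * (case p of (x, y) \<Rightarrow> f x * g y))"
      by (intro AE_I2) (auto simp: space_pair_measure)
  qed
qed

lemma integrable_kernel_squares:
  assumes K: "bounded_kernel M K" and u: "square_integrable M u"
  shows "integrable (M \<Otimes>\<^sub>M M) (\<lambda>(x, y). K x y * (u x)\<^sup>2)"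
    and "integrable (M \<Otimes>\<^sub>M M) (\<lambda>(x, y). K x y * (u y)\<^sup>2)"
    and "integrable (M \<Otimes>\<^sub>M M) (\<lambda>(x, y). K x y * (u x * u y))"
proof -
  have 1: "integrable M (\<lambda>x. 1 :: real)" by simp
  have 2: "integrable M (\<lambda>x. (u x)\<^sup>2)" using u by (simp add: square_integrable_def)
  note 3 = square_integrable_imp_integrable[OF u]
  show "integrable (M \<Otimes>\<^sub>M M) (\<lambda>(x, y). K x y * (u x)\<^sup>2)"
    using integrable_kernel_mult[OF K 2 1] by simp
  show "integrable (M \<Otimes>\<^sub>M M) (\<lambda>(x, y). K x y * (u y)\<^sup>2)"
    using integrable_kernel_mult[OF K 1 2] by simp
  show "integrable (M \<Otimes>\<^sub>M M) (\<lambda>(x, y). K x y * (u x * u y))"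
    by (rule integrable_kernel_mult[OF K 3 3])
qed

lemma integrable_dirichlet_form:
  assumes K: "bounded_kernel M K" and u: "square_integrable M u"
  shows "integrable (M \<Otimes>\<^sub>M M) (\<lambda>(x, y). K x y * (u x - u y)\<^sup>2)"
proof -
  note I = integrable_kernel_squares[OF K u]
  have "integrable (M \<Otimes>\<^sub>M M) (\<lambda>p. (case p of (x, y) \<Rightarrow> K x y * (u x)\<^sup>2)
          + (case p of (x, y) \<Rightarrow> K x y * (u y)\<^sup>2)
          - 2 * (case p of (x, y) \<Rightarrow> K x y * (u x * u y)))"
    using I by (intro Bochner_Integration.integrable_add Bochner_Integration.integrable_diff
        integrable_mult_right)
  also have "(\<lambda>p. (case p of (x, y) \<Rightarrow> K x y * (u x)\<^sup>2)
          + (case p of (x, y) \<Rightarrow> K x y * (u y)\<^sup>2)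
          - 2 * (case p of (x, y) \<Rightarrow> K x y * (u x * u y))) = (\<lambda>(x, y). K x y * (u x - u y)\<^sup>2)"
    by (auto simp: fun_eq_iff power2_eq_square algebra_simps)
  finally show ?thesis .
qed

lemma dirichlet_form_mono:
  assumes "bounded_kernel M K" "bounded_kernel M L" "square_integrable M u"
    and "\<And>x y. x \<in> space M \<Longrightarrow> y \<in> space M \<Longrightarrow> K x y \<le> L x y"
  shows "dirichlet_form M K u \<le> dirichlet_form M L u"
  unfolding dirichlet_form_def
proof (rule integral_mono)
  fix p assume "p \<in> space (M \<Otimes>\<^sub>M M)"
  then show "(case p of (x, y) \<Rightarrow> K x y * (u x - u y)\<^sup>2) \<le> (case p of (x, y) \<Rightarrow> L x y * (u x - u y)\<^sup>2)"
    using assms(4) by (auto simp: space_pair_measure intro!: mult_right_mono)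
qed (use assms integrable_dirichlet_form in auto)

lemma dirichlet_form_cmult: "dirichlet_form M (\<lambda>x y. c * K x y) u = c * dirichlet_form M K u"
proof -
  have "(\<lambda>(x, y). c * K x y * (u x - u y)\<^sup>2) = (\<lambda>p. c * (case p of (x, y) \<Rightarrow> K x y * (u x - u y)\<^sup>2))"
    by (auto simp: fun_eq_iff)
  then show ?thesis by (simp add: dirichlet_form_def)
qed

lemma dirichlet_form_sum:
  assumes "\<And>i. i \<in> I \<Longrightarrow> bounded_kernel M (K i)" and u: "square_integrable M u"
  shows "dirichlet_form M (\<lambda>x y. \<Sum>i\<in>I. K i x y) u = (\<Sum>i\<in>I. dirichlet_form M (K i) u)"
proof -
  have "(\<lambda>(x, y). (\<Sum>i\<in>I. K i x y) * (u x - u y)\<^sup>2)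
      = (\<lambda>p. \<Sum>i\<in>I. (case p of (x, y) \<Rightarrow> K i x y * (u x - u y)\<^sup>2))"
    by (auto simp: fun_eq_iff sum_distrib_right)
  then show ?thesis
    using integrable_dirichlet_form[OF assms(1) u]
    by (simp add: dirichlet_form_def)
qed

lemma integrable_kernel_flux:
  assumes K: "bounded_kernel M K" and u: "square_integrable M u" and v: "square_integrable M v"
  shows "integrable (M \<Otimes>\<^sub>M M) (\<lambda>(x, y). v x * (K x y * (u y - u x)))"
proof -
  note ui = square_integrable_imp_integrable[OF u] 
    and vi = square_integrable_imp_integrable[OF v] 
    and uv = integrable_mult_square_integrable[OF v u]
  have 1: "integrable M (\<lambda>x. 1 :: real)" by simp
  have "integrable (M \<Otimes>\<^sub>M M) (\<lambda>p. (case p of (x, y) \<Rightarrow> K x y * (v x * u y))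
      - (case p of (x, y) \<Rightarrow> K x y * (v x * u x * 1)))"
    by (intro Bochner_Integration.integrable_diff integrable_kernel_mult[OF K vi ui]
        integrable_kernel_mult[OF K uv 1])
  also have "(\<lambda>p. (case p of (x, y) \<Rightarrow> K x y * (v x * u y))
      - (case p of (x, y) \<Rightarrow> K x y * (v x * u x * 1))) = (\<lambda>(x, y). v x * (K x y * (u y - u x)))"
    by (auto simp: fun_eq_iff algebra_simps)
  finally show ?thesis .
qed

lemma integrable_nonlocal_operator:
  assumes K: "bounded_kernel M K" and u: "square_integrable M u" and v: "square_integrable M v"
  shows "integrable M (\<lambda>x. v x * (\<integral>y. K x y * (u y - u x) \<partial>M))"
  using P.integrable_fst'[OF integrable_kernel_flux[OF assms]] by simp

text \<open>
  Averaging the double integral with its image under exchange of \<open>x\<close> and \<open>y\<close> moves the difference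
  onto the test function \<open>v\<close>: this is the integration by parts of nonlocal diffusion.  The choices
  \<open>v = 1\<close> and \<open>v = u\<close> give conservation of mass and dissipation of energy.
\<close>

lemma integral_kernel_flux_antisym:
  assumes K: "bounded_kernel M K" and sym: "\<And>x y. K x y = K y x"
    and u: "square_integrable M u" and v: "square_integrable M v"
  shows "2 * (\<integral>x. v x * (\<integral>y. K x y * (u y - u x) \<partial>M) \<partial>M)
       = (\<integral>(x, y). K x y * ((v x - v y) * (u y - u x)) \<partial>(M \<Otimes>\<^sub>M M))"
proof -
  let ?F = "\<lambda>(x, y). v x * (K x y * (u y - u x))"
  note I = integrable_kernel_flux[OF K u v]
  have "(\<integral>x. v x * (\<integral>y. K x y * (u y - u x) \<partial>M) \<partial>M) = integral\<^sup>L (M \<Otimes>\<^sub>M M) ?F"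
    using P.integral_fst'[OF I] by simp
  moreover have "integral\<^sup>L (M \<Otimes>\<^sub>M M) ?F = (\<integral>(x, y). ?F (y, x) \<partial>(M \<Otimes>\<^sub>M M))"
    using P.integral_product_swap[OF borel_measurable_integrable[OF I]] by simp
  moreover have "integral\<^sup>L (M \<Otimes>\<^sub>M M) ?F + (\<integral>(x, y). ?F (y, x) \<partial>(M \<Otimes>\<^sub>M M))
      = (\<integral>p. ?F p + (case p of (x, y) \<Rightarrow> ?F (y, x)) \<partial>(M \<Otimes>\<^sub>M M))"
    by (rule Bochner_Integration.integral_add[symmetric, OF I P.integrable_product_swap[OF I]])
  moreover have "(\<lambda>p. ?F p + (case p of (x, y) \<Rightarrow> ?F (y, x)))
      = (\<lambda>(x, y). K x y * ((v x - v y) * (u y - u x)))"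
    by (auto simp: fun_eq_iff sym algebra_simps)
  ultimately show ?thesis by simp
qed

lemma integral_nonlocal_operator_eq_0:
  assumes "bounded_kernel M K" "\<And>x y. K x y = K y x" "square_integrable M u"
  shows "(\<integral>x. (\<integral>y. K x y * (u y - u x) \<partial>M) \<partial>M) = 0"
  using integral_kernel_flux_antisym[OF assms square_integrable_const[of 1]]
  by (simp add: split_def)

lemma integral_nonlocal_operator_energy:
  assumes "bounded_kernel M K" "\<And>x y. K x y = K y x" "square_integrable M u"
  shows "2 * (\<integral>x. u x * (\<integral>y. K x y * (u y - u x) \<partial>M) \<partial>M) = - dirichlet_form M K u"
proof -
  have "(\<lambda>(x, y). K x y * ((u x - u y) * (u y - u x)))
      = (\<lambda>p. - (case p of (x, y) \<Rightarrow> K x y * (u x - u y)\<^sup>2))"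
    by (auto simp: fun_eq_iff power2_eq_square algebra_simps)
  then show ?thesis
    unfolding dirichlet_form_def integral_kernel_flux_antisym[OF assms assms(3)] by simp
qed

text \<open>
  For kernels that are indicators of rectangles the form is an explicit expression in the zeroth, first and
  second moments of \<open>u\<close> on the two sides.  This reduces comparisons between such forms to algebra.
\<close>

lemma dirichlet_form_blocks:
  assumes D: "D \<in> sets M" and E: "E \<in> sets M" and u: "square_integrable M u"
  shows "dirichlet_form M (\<lambda>x y. indicat_real D x * indicat_real E y) u
       = measure M E * (\<integral>x. indicat_real D x * (u x)\<^sup>2 \<partial>M)
       + measure M D * (\<integral>x. indicat_real E x * (u x)\<^sup>2 \<partial>M)
       - 2 * (\<integral>x. indicat_real D x * u x \<partial>M) * (\<integral>x. indicat_real E x * u x \<partial>M)"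
proof -
  have sq: "integrable M (\<lambda>x. (u x)\<^sup>2)" using u by (simp add: square_integrable_def)
  note ui = square_integrable_imp_integrable[OF u]
  have int: "integrable M (\<lambda>x. indicat_real S x * f x)"
    if "S \<in> sets M" "integrable M f" for S and f :: "'a \<Rightarrow> real"
    using integrable_mult_indicator[OF that] by simp
  have one: "integrable M (indicat_real S)" if "S \<in> sets M" for S
    using that by (simp add: emeasure_eq_measure)
  have "dirichlet_form M (\<lambda>x y. indicat_real D x * indicat_real E y) u
      = (\<integral>x. (\<integral>y. indicat_real D x * indicat_real E y * (u x - u y)\<^sup>2 \<partial>M) \<partial>M)"
    unfolding dirichlet_form_def
    using P.integral_fst'[OF integrable_dirichlet_form[OF bounded_kernel_blocks[OF D E] u]] by simp
  also have "\<dots> = (\<integral>x. measure M E * (indicat_real D x * (u x)\<^sup>2)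
        + (\<integral>y. indicat_real E y * (u y)\<^sup>2 \<partial>M) * indicat_real D x
        - 2 * (\<integral>y. indicat_real E y * u y \<partial>M) * (indicat_real D x * u x) \<partial>M)"
  proof (rule Bochner_Integration.integral_cong[OF refl])
    fix x
    have "(\<lambda>y. indicat_real D x * indicat_real E y * (u x - u y)\<^sup>2)
        = (\<lambda>y. indicat_real D x * (u x)\<^sup>2 * indicat_real E y
              + indicat_real D x * (indicat_real E y * (u y)\<^sup>2)
              - 2 * indicat_real D x * u x * (indicat_real E y * u y))"
      by (auto simp: fun_eq_iff power2_eq_square algebra_simps)
    then show "(\<integral>y. indicat_real D x * indicat_real E y * (u x - u y)\<^sup>2 \<partial>M)
        = measure M E * (indicat_real D x * (u x)\<^sup>2)
        + (\<integral>y. indicat_real E y * (u y)\<^sup>2 \<partial>M) * indicat_real D x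
        - 2 * (\<integral>y. indicat_real E y * u y \<partial>M) * (indicat_real D x * u x)"
      using int[OF E sq] int[OF E ui] one[OF E] E by simp
  qed
  also have "\<dots> = measure M E * (\<integral>x. indicat_real D x * (u x)\<^sup>2 \<partial>M)
       + measure M D * (\<integral>x. indicat_real E x * (u x)\<^sup>2 \<partial>M)
       - 2 * (\<integral>x. indicat_real D x * u x \<partial>M) * (\<integral>x. indicat_real E x * u x \<partial>M)"
    using int[OF D sq] int[OF D ui] one[OF D] D by simp
  finally show ?thesis .
qed

lemma integral_on_square_le:
  assumes D: "D \<in> sets M" and u: "square_integrable M u"
  shows "(\<integral>x. indicat_real D x * u x \<partial>M)\<^sup>2 \<le> measure M D * (\<integral>x. indicat_real D x * (u x)\<^sup>2 \<partial>M)"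
proof -
  have [measurable]: "u \<in> borel_measurable M" using u by (simp add: square_integrable_def)
  note [measurable] = D
  have sq: "integrable M (\<lambda>x. (u x)\<^sup>2)" using u by (simp add: square_integrable_def)
  have eq: "(\<lambda>x. (indicat_real D x)\<^sup>2) = indicat_real D"
    "(\<lambda>x. (indicat_real D x * u x)\<^sup>2) = (\<lambda>x. indicat_real D x * (u x)\<^sup>2)"
    "(\<lambda>x. indicat_real D x * (indicat_real D x * u x)) = (\<lambda>x. indicat_real D x * u x)"
    by (auto simp: fun_eq_iff indicator_def)
  have "square_integrable M (indicat_real D)"
    unfolding square_integrable_def eq using D by (simp add: emeasure_eq_measure)
  moreover have "square_integrable M (\<lambda>x. indicat_real D x * u x)"
    unfolding square_integrable_def eq using integrable_mult_indicator[OF D sq] by simp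
  ultimately show ?thesis
    using Cauchy_Schwarz_integral[of M "indicat_real D" "\<lambda>x. indicat_real D x * u x"] D
    by (simp add: eq)
qed

text \<open>
  Integrating \<open>(u(x) - u(z))\<^sup>2 \<le> 2 (u(x) - u(y))\<^sup>2 + 2 (u(y) - u(z))\<^sup>2\<close> over
  \<open>x \<in> D\<close>, \<open>y \<in> E\<close>, \<open>z \<in> F\<close> gives the claim.  The proof avoids the triple integral:
  in terms of moments, the difference of the two sides is a nonnegative combination of variances plus a multiple of
  \<open>(a\<^sub>D + a\<^sub>F - 2 a\<^sub>E)\<^sup>2\<close>, where \<open>a\<close> denotes the mean of \<open>u\<close>.
\<close>

lemma dirichlet_form_blocks_trans:
  assumes D: "D \<in> sets M" and E: "E \<in> sets M" and F: "F \<in> sets M"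
    and u: "square_integrable M u"
    and pos: "0 < measure M D" "0 < measure M E" "0 < measure M F"
  shows "measure M E * dirichlet_form M (\<lambda>x y. indicat_real D x * indicat_real F y) u
    \<le> 2 * measure M F * dirichlet_form M (\<lambda>x y. indicat_real D x * indicat_real E y) u
    + 2 * measure M D * dirichlet_form M (\<lambda>x y. indicat_real E x * indicat_real F y) u"
proof -
  define d e f where "d = measure M D" "e = measure M E" "f = measure M F"
  define s where "s S = (\<integral>x. indicat_real S x * u x \<partial>M)" for S
  define q where "q S = (\<integral>x. indicat_real S x * (u x)\<^sup>2 \<partial>M)" for S
  have pos': "d > 0" "e > 0" "f > 0" using pos by (auto simp: d_e_f_def)
  have le: "(s D)\<^sup>2 / d \<le> q D" "(s E)\<^sup>2 / e \<le> q E" "(s F)\<^sup>2 / f \<le> q F"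
    using integral_on_square_le[OF D u] integral_on_square_le[OF E u]
      integral_on_square_le[OF F u] pos'
    by (auto simp: divide_le_eq s_def q_def d_e_f_def mult.commute)
  have "0 \<le> d * e * f * (s D / d + s F / f - 2 * (s E / e))\<^sup>2"
    using pos' by simp
  also have "\<dots> = e * f * ((s D)\<^sup>2 / d) + d * e * ((s F)\<^sup>2 / f) + 4 * d * f * ((s E)\<^sup>2 / e)
      - 4 * f * s D * s E - 4 * d * s E * s F + 2 * e * s D * s F"
    using pos' by (simp add: field_simps power2_eq_square)
  also have "\<dots> \<le> e * f * q D + d * e * q F + 4 * d * f * q E
      - 4 * f * s D * s E - 4 * d * s E * s F + 2 * e * s D * s F"
  proof -
    have "e * f * ((s D)\<^sup>2 / d) \<le> e * f * q D" "d * e * ((s F)\<^sup>2 / f) \<le> d * e * q F"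
      "4 * d * f * ((s E)\<^sup>2 / e) \<le> 4 * d * f * q E"
      by (intro mult_left_mono le; use pos' in simp)+
    then show ?thesis by linarith
  qed
  finally have "e * (f * q D + d * q F - 2 * s D * s F)
    \<le> 2 * f * (e * q D + d * q E - 2 * s D * s E) + 2 * d * (f * q E + e * q F - 2 * s E * s F)"
    by (simp add: algebra_simps)
  then show ?thesis
    unfolding dirichlet_form_blocks[OF D F u] dirichlet_form_blocks[OF D E u]
      dirichlet_form_blocks[OF E F u] s_def q_def d_e_f_def .
qed

end

section \<open>A nonlocal Poincare inequality\<close>

lemma bounded_kernel_near:
  fixes S :: "'a::euclidean_space set"
  shows "bounded_kernel (lebesgue_on S) (\<lambda>x y. c * (if dist x y < \<delta> then 1 else 0))"
proof -
  let ?M = "lebesgue_on S"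
  define d :: "'a \<times> 'a \<Rightarrow> real" where "d = (\<lambda>(x, y). dist x y)"
  have [measurable]: "d \<in> borel_measurable (?M \<Otimes>\<^sub>M ?M)"
    unfolding d_def
    by (rule continuous_kernel_measurable) (auto simp: split_def intro!: continuous_intros)
  have "(\<lambda>p. c * (if d p < \<delta> then 1 else 0)) \<in> borel_measurable (?M \<Otimes>\<^sub>M ?M)"
    by measurable
  also have "(\<lambda>p. c * (if d p < \<delta> then 1 else 0)) = (\<lambda>(x, y). c * (if dist x y < \<delta> then 1 else 0))"
    by (auto simp: d_def fun_eq_iff)
  finally show ?thesis
    unfolding bounded_kernel_def by (auto intro!: exI[of _ "\<bar>c\<bar>"])
qed

text \<open>
  A chaining argument.  Around each point of \<open>\<Omega>\<close> take the part in \<open>\<Omega>\<close> of a ball of radius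
  \<open>\<delta> / 4\<close>.  If two centres are less than \<open>\<delta> / 2\<close> apart, then all pairs of points of the
  two pieces are within \<open>\<delta>\<close>, so the square differences of \<open>u\<close> between the pieces are part of
  the form on the right.  Transitivity through a third piece costs a constant factor, because every
  piece has positive measure, and connectedness links any two centres.  Summing over a finite cover bounds
  the full double integral \<open>\<integral>\<integral> (u(x) - u(y))\<^sup>2\<close>, which is twice the left-hand side.
\<close>

lemma nonlocal_Poincare:
  fixes \<Omega> :: "'a::euclidean_space set"
  assumes "open \<Omega>" "connected \<Omega>" "bounded \<Omega>" and \<delta>: "0 < \<delta>"
  shows "\<exists>C>0. \<forall>u. square_integrable (lebesgue_on \<Omega>) u \<longrightarrow>
           measure lebesgue \<Omega> * (\<integral>x. (u x)\<^sup>2 \<partial>lebesgue_on \<Omega>) - (\<integral>x. u x \<partial>lebesgue_on \<Omega>)\<^sup>2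
             \<le> C * dirichlet_form (lebesgue_on \<Omega>) (\<lambda>x y. if dist x y < \<delta> then 1 else 0) u"
proof -
  define M where "M = lebesgue_on \<Omega>"
  define near :: "'a \<Rightarrow> 'a \<Rightarrow> real" where "near = (\<lambda>x y. if dist x y < \<delta> then 1 else 0)"
  have \<Omega>_meas: "\<Omega> \<in> lmeasurable"
    using assms by (simp add: lmeasurable_open)
  have \<Omega>_sets: "\<Omega> \<in> sets lebesgue" using \<Omega>_meas by auto
  interpret finite_measure M
    unfolding M_def using \<Omega>_meas by (rule finite_measure_lebesgue_on)
  have sp: "space M = \<Omega>" by (simp add: M_def)
  have near: "bounded_kernel M near"
    unfolding M_def near_def using bounded_kernel_near[of \<Omega> 1 \<delta>] by simp
  define D where "D c = ball c (\<delta> / 4) \<inter> \<Omega>" for c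
  have D_sets: "D c \<in> sets M" for c
    using \<Omega>_sets by (auto simp: D_def M_def sets_restrict_space_iff)
  have D_pos: "0 < measure M (D c)" if "c \<in> \<Omega>" for c
  proof -
    have op: "open (D c)" using \<open>open \<Omega>\<close> by (auto simp: D_def)
    have "c \<in> D c" using that \<delta> by (simp add: D_def)
    then have "\<not> negligible (D c)"
      using op open_not_negligible by blast
    moreover have "D c \<in> lmeasurable"
      using op \<open>bounded \<Omega>\<close> by (intro lmeasurable_open) (auto simp: D_def intro: bounded_subset)
    ultimately have "measure lebesgue (D c) > 0"
      by (metis measure_nonneg negligible_iff_measure order_less_le)
    then show ?thesis
      unfolding M_def using \<Omega>_sets by (subst measure_restrict_space) (auto simp: D_def)
  qed
  define E where "E b c = dirichlet_form M (\<lambda>x y. indicat_real (D b) x * indicat_real (D c) y)" for b c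
  \<comment> \<open>\<open>R b c\<close>: the square differences between the pieces at \<open>b\<close> and \<open>c\<close> are controlled uniformly in \<open>u\<close>.\<close>
  define R where "R b c \<longleftrightarrow> (\<exists>C\<ge>0. \<forall>u. square_integrable M u \<longrightarrow> E b c u \<le> C * dirichlet_form M near u)" for b c
  have near_R: "R b c" if "dist b c < \<delta> / 2" for b c
  proof -
    have "E b c u \<le> 1 * dirichlet_form M near u" if u: "square_integrable M u" for u
      unfolding E_def mult_1
    proof (rule dirichlet_form_mono[OF bounded_kernel_blocks[OF D_sets D_sets] near u])
      fix x y
      have "dist x y < \<delta>" if "x \<in> D b" "y \<in> D c"
      proof -
        have "dist x y \<le> dist b x + dist b c + dist c y"
          using dist_triangle[of x y b] dist_triangle[of b y c] by (simp add: dist_commute)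
        then show ?thesis using that \<open>dist b c < \<delta> / 2\<close> by (simp add: D_def)
      qed
      then show "indicat_real (D b) x * indicat_real (D c) y \<le> near x y"
        by (auto simp: near_def indicator_def)
    qed
    then show ?thesis unfolding R_def by (intro exI[of _ 1]) auto
  qed
  have R_sym: "R c b" if "R b c" for b c
  proof -
    have "E c b u = E b c u" if "square_integrable M u" for u
      unfolding E_def dirichlet_form_blocks[OF D_sets D_sets that] by simp
    then show ?thesis using \<open>R b c\<close> by (auto simp: R_def)
  qed
  have R_trans: "R b d" if bc: "R b c" and cd: "R c d" and in\<Omega>: "b \<in> \<Omega>" "c \<in> \<Omega>" "d \<in> \<Omega>" for b c d
  proof -
    obtain C1 where C1: "C1 \<ge> 0" "\<And>u. square_integrable M u \<Longrightarrow> E b c u \<le> C1 * dirichlet_form M near u"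
      using bc by (auto simp: R_def)
    obtain C2 where C2: "C2 \<ge> 0" "\<And>u. square_integrable M u \<Longrightarrow> E c d u \<le> C2 * dirichlet_form M near u"
      using cd by (auto simp: R_def)
    define mb mc md where "mb = measure M (D b)" "mc = measure M (D c)" "md = measure M (D d)"
    have pos: "mb > 0" "mc > 0" "md > 0" using D_pos in\<Omega> by (auto simp: mb_mc_md_def)
    have "E b d u \<le> (2 * md * C1 + 2 * mb * C2) / mc * dirichlet_form M near u"
      if u: "square_integrable M u" for u
    proof -
      have "mc * E b d u \<le> 2 * md * E b c u + 2 * mb * E c d u"
        unfolding E_def mb_mc_md_def
        by (rule dirichlet_form_blocks_trans) (use D_sets D_pos in\<Omega> u in auto)
      also have "\<dots> \<le> 2 * md * (C1 * dirichlet_form M near u) + 2 * mb * (C2 * dirichlet_form M near u)"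
        using C1(2)[OF u] C2(2)[OF u] pos by (intro add_mono mult_left_mono) auto
      finally show ?thesis using pos by (simp add: field_simps)
    qed
    moreover have "(2 * md * C1 + 2 * mb * C2) / mc \<ge> 0" using pos C1(1) C2(1) by simp
    ultimately show ?thesis unfolding R_def by blast
  qed
  have R_all: "R b c" if "b \<in> \<Omega>" "c \<in> \<Omega>" for b c
  proof (rule connected_equivalence_relation[OF \<open>connected \<Omega>\<close> that])
    fix a assume "a \<in> \<Omega>"
    then show "\<exists>T. openin (top_of_set \<Omega>) T \<and> a \<in> T \<and> (\<forall>x\<in>T. R a x)"
      using near_R \<delta> by (intro exI[of _ "\<Omega> \<inter> ball a (\<delta> / 2)"]) auto
  qed (erule R_sym, erule (4) R_trans)
  define C where "C b c = (SOME C. C \<ge> 0 \<and>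
      (\<forall>u. square_integrable M u \<longrightarrow> E b c u \<le> C * dirichlet_form M near u))" for b c
  have C0: "C b c \<ge> 0"
    and C: "square_integrable M u \<Longrightarrow> E b c u \<le> C b c * dirichlet_form M near u"
    if "b \<in> \<Omega>" "c \<in> \<Omega>" for b c u
    using someI_ex[OF R_all[OF that, unfolded R_def]] unfolding C_def by blast+
  \<comment> \<open>The closure of \<open>\<Omega>\<close> is compact, and every point of it is near some centre in \<open>\<Omega>\<close> itself.\<close>
  obtain T where T: "T \<subseteq> \<Omega>" "finite T" "\<Omega> \<subseteq> (\<Union>c\<in>T. ball c (\<delta> / 4))"
  proof -
    have "\<Omega> \<subseteq> closure \<Omega>" by (rule closure_subset)
    moreover have "closure \<Omega> \<subseteq> (\<Union>c\<in>\<Omega>. ball c (\<delta> / 4))"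
    proof
      fix x assume "x \<in> closure \<Omega>"
      moreover have "\<delta> / 4 > 0" using \<delta> by simp
      ultimately obtain c where "c \<in> \<Omega>" "dist c x < \<delta> / 4"
        unfolding closure_approachable by blast
      then show "x \<in> (\<Union>c\<in>\<Omega>. ball c (\<delta> / 4))" by auto
    qed
    moreover have "compact (closure \<Omega>)" using \<open>bounded \<Omega>\<close> by (simp add: compact_closure)
    ultimately obtain T where "T \<subseteq> \<Omega>" "finite T" "closure \<Omega> \<subseteq> (\<Union>c\<in>T. ball c (\<delta> / 4))"
      using compactE_image[of "closure \<Omega>" \<Omega> "\<lambda>c. ball c (\<delta> / 4)"] by (metis open_ball)
    then show ?thesis using that \<open>\<Omega> \<subseteq> closure \<Omega>\<close> by (meson order_trans)
  qed
  define CT where "CT = (\<Sum>(b, c)\<in>T \<times> T. C b c)"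
  have "CT \<ge> 0"
    unfolding CT_def using C0 T(1) by (intro sum_nonneg) auto
  \<comment> \<open>The summand 1 makes the constant positive.\<close>
  have "measure lebesgue \<Omega> * (\<integral>x. (u x)\<^sup>2 \<partial>M) - (\<integral>x. u x \<partial>M)\<^sup>2 \<le> (CT + 1) * dirichlet_form M near u"
    if u: "square_integrable M u" for u
  proof -
    have nonneg: "dirichlet_form M near u \<ge> 0"
      unfolding dirichlet_form_def near_def by (intro integral_nonneg_AE AE_I2) (auto split: prod.split)
    have top: "\<Omega> \<in> sets M" using sets.top[of M] by (simp add: sp)
    have meas: "measure M \<Omega> = measure lebesgue \<Omega>"
      unfolding M_def using \<Omega>_sets by (subst measure_restrict_space) auto
    have restr: "(\<integral>x. indicat_real \<Omega> x * f x \<partial>M) = (\<integral>x. f x \<partial>M)" for f :: "'a \<Rightarrow> real"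
      by (intro Bochner_Integration.integral_cong) (auto simp: sp)
    have "2 * (measure lebesgue \<Omega> * (\<integral>x. (u x)\<^sup>2 \<partial>M) - (\<integral>x. u x \<partial>M)\<^sup>2)
        = dirichlet_form M (\<lambda>x y. indicat_real \<Omega> x * indicat_real \<Omega> y) u"
      unfolding dirichlet_form_blocks[OF top top u] restr meas
      by (simp add: algebra_simps power2_eq_square)
    also have "\<dots> \<le> dirichlet_form M (\<lambda>x y. \<Sum>p\<in>T \<times> T. indicat_real (D (fst p)) x * indicat_real (D (snd p)) y) u"
    proof (rule dirichlet_form_mono[OF bounded_kernel_blocks[OF top top] _ u])
      have prod: "(\<Sum>p\<in>T \<times> T. indicat_real (D (fst p)) x * indicat_real (D (snd p)) y)
          = (\<Sum>b\<in>T. indicat_real (D b) x) * (\<Sum>c\<in>T. indicat_real (D c) y)" for x y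
        by (simp add: sum_product sum.cartesian_product split_def)
      have cover: "1 \<le> (\<Sum>b\<in>T. indicat_real (D b) x)" "(\<Sum>b\<in>T. indicat_real (D b) x) \<le> card T"
        if "x \<in> \<Omega>" for x
      proof -
        obtain b where "b \<in> T" "x \<in> D b" using T(3) \<open>x \<in> \<Omega>\<close> by (auto simp: D_def)
        then show "1 \<le> (\<Sum>b\<in>T. indicat_real (D b) x)"
          using member_le_sum[of b T "\<lambda>b. indicat_real (D b) x"] T(2) by simp
        show "(\<Sum>b\<in>T. indicat_real (D b) x) \<le> card T"
          using sum_bounded_above[of T "\<lambda>b. indicat_real (D b) x" 1] by (simp add: indicator_def)
      qed
      show "bounded_kernel M (\<lambda>x y. \<Sum>p\<in>T \<times> T. indicat_real (D (fst p)) x * indicat_real (D (snd p)) y)"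
        unfolding bounded_kernel_def
      proof (intro conjI exI ballI)
        note [measurable] = D_sets
        show "(\<lambda>(x, y). \<Sum>p\<in>T \<times> T. indicat_real (D (fst p)) x * indicat_real (D (snd p)) y)
            \<in> borel_measurable (M \<Otimes>\<^sub>M M)" by measurable
        fix x y assume "x \<in> space M" "y \<in> space M"
        then show "\<bar>\<Sum>p\<in>T \<times> T. indicat_real (D (fst p)) x * indicat_real (D (snd p)) y\<bar> \<le> real (card T) * real (card T)"
          unfolding prod abs_mult using cover[of x] cover[of y]
          by (intro mult_mono) (auto simp: sp)
      qed
      fix x y assume "x \<in> space M" "y \<in> space M"
      then show "indicat_real \<Omega> x * indicat_real \<Omega> y
          \<le> (\<Sum>p\<in>T \<times> T. indicat_real (D (fst p)) x * indicat_real (D (snd p)) y)"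
        unfolding prod
        using mult_mono[OF cover(1)[of x] cover(1)[of y]] cover(1)[of x] by (simp add: sp)
    qed
    also have "\<dots> = (\<Sum>p\<in>T \<times> T. E (fst p) (snd p) u)"
      unfolding E_def by (intro dirichlet_form_sum bounded_kernel_blocks D_sets u)
    also have "\<dots> \<le> (\<Sum>p\<in>T \<times> T. C (fst p) (snd p) * dirichlet_form M near u)"
      by (intro sum_mono C u) (use T(1) in auto)
    also have "\<dots> = CT * dirichlet_form M near u"
      by (simp add: CT_def sum_distrib_right split_def)
    also have "\<dots> \<le> 2 * ((CT + 1) * dirichlet_form M near u)"
      using nonneg \<open>CT \<ge> 0\<close> by (simp add: algebra_simps)
    finally show ?thesis by simp
  qed
  then show ?thesis
    using \<open>CT \<ge> 0\<close> unfolding M_def near_def by (intro exI[of _ "CT + 1"]) auto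
qed

section \<open>Differentiating integrals along L2-differentiable curves\<close>

lemma mem_L2_iff: "u \<in> L2 S \<longleftrightarrow> square_integrable (lebesgue_on S) u"
  by (simp add: L2_def square_integrable_def)

lemma abs_integral_mult_le_L2_norm:
  assumes "u \<in> L2 S" "v \<in> L2 S"
  shows "\<bar>\<integral>x. u x * v x \<partial>lebesgue_on S\<bar> \<le> L2_norm S u * L2_norm S v"
  using real_sqrt_le_mono[OF Cauchy_Schwarz_integral[of "lebesgue_on S" u v]] assms
  by (simp add: L2_norm_def real_sqrt_mult mem_L2_iff)

lemma L2_difference_quotient_remainder:
  assumes "u s \<in> L2 S" "u t \<in> L2 S" "D \<in> L2 S"
  shows "(\<lambda>x. (u s x - u t x) / (s - t) - D x) \<in> L2 S"
  using square_integrable_diff[OF square_integrable_cmult[OF square_integrable_diff, of _ "u s" "u t" "1 / (s - t)"]]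
    assms by (simp add: mem_L2_iff)

lemma L2_norm_sq: "(L2_norm S f)\<^sup>2 = (\<integral>x. (f x)\<^sup>2 \<partial>lebesgue_on S)"
  by (simp add: L2_norm_def)

text \<open>
  Integration against 1 is a bounded linear functional on \<open>L2\<close> of a set of finite measure, so it
  commutes with the \<open>L2\<close> derivative.
\<close>

lemma has_real_derivative_integral_L2:
  assumes fin: "S \<in> lmeasurable" and u: "\<And>s. 0 \<le> s \<Longrightarrow> u s \<in> L2 S"
    and der: "has_L2_time_derivative S u D t" and t: "0 \<le> t"
  shows "((\<lambda>s. \<integral>x. u s x \<partial>lebesgue_on S) has_real_derivative (\<integral>x. D x \<partial>lebesgue_on S)) (at t within {0..})"
proof -
  define M where "M = lebesgue_on S"
  interpret finite_measure M
    unfolding M_def using fin by (rule finite_measure_lebesgue_on)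
  define r where "r s = (\<lambda>x. (u s x - u t x) / (s - t) - D x)" for s
  have D: "D \<in> L2 S" and lim: "((\<lambda>s. L2_norm S (r s)) \<longlongrightarrow> 0) (at t within {0..})"
    using der by (auto simp: has_L2_time_derivative_def r_def)
  have rL2: "r s \<in> L2 S" if "0 \<le> s" for s
    unfolding r_def using u[OF that] u[OF t] D by (rule L2_difference_quotient_remainder)
  have one: "(\<lambda>x. 1) \<in> L2 S"
    using square_integrable_const by (simp add: mem_L2_iff M_def)
  have int: "integrable M f" if "f \<in> L2 S" for f
    using that square_integrable_imp_integrable by (simp add: mem_L2_iff M_def)
  have "((\<lambda>s. \<integral>x. r s x \<partial>M) \<longlongrightarrow> 0) (at t within {0..})"
  proof (rule Lim_null_comparison)
    show "((\<lambda>s. L2_norm S (r s) * L2_norm S (\<lambda>x. 1)) \<longlongrightarrow> 0) (at t within {0..})"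
      using tendsto_mult_left_zero[OF lim] .
    show "\<forall>\<^sub>F s in at t within {0..}. norm (\<integral>x. r s x \<partial>M) \<le> L2_norm S (r s) * L2_norm S (\<lambda>x. 1)"
      using abs_integral_mult_le_L2_norm[OF rL2 one]
      by (auto simp: eventually_at_filter M_def)
  qed
  then have "((\<lambda>s. (\<integral>x. D x \<partial>M) + (\<integral>x. r s x \<partial>M)) \<longlongrightarrow> (\<integral>x. D x \<partial>M)) (at t within {0..})"
    by (auto intro: tendsto_eq_intros)
  moreover have "\<forall>\<^sub>F s in at t within {0..}. (\<integral>x. D x \<partial>M) + (\<integral>x. r s x \<partial>M)
      = ((\<integral>x. u s x \<partial>M) - (\<integral>x. u t x \<partial>M)) / (s - t)"
  proof -
    have "(\<integral>x. D x \<partial>M) + (\<integral>x. r s x \<partial>M) = ((\<integral>x. u s x \<partial>M) - (\<integral>x. u t x \<partial>M)) / (s - t)"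
      if "s \<ge> 0" for s
      using int[OF u[OF that]] int[OF u[OF t]] int[OF D] by (simp add: r_def)
    then show ?thesis by (auto simp: eventually_at_filter)
  qed
  ultimately show ?thesis
    unfolding has_field_derivative_iff M_def by (rule Lim_transform_eventually)
qed

text \<open>
  With \<open>w = u - c\<close> and \<open>r s\<close> the remainder of the difference quotient,
  \<open>w s = w t + (s - t) (D + r s)\<close>.  Expanding the square, the difference quotient of \<open>\<integral> w\<^sup>2\<close> is
  \<open>2 \<integral> w t D\<close> plus an error that Cauchy-Schwarz controls by the \<open>L2\<close> norm of
  \<open>r s\<close> and by \<open>|s - t|\<close>.
\<close>

lemma has_real_derivative_integral_square_L2:
  assumes fin: "S \<in> lmeasurable" and u: "\<And>s. 0 \<le> s \<Longrightarrow> u s \<in> L2 S"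
    and der: "has_L2_time_derivative S u D t" and t: "0 \<le> t"
  shows "((\<lambda>s. \<integral>x. (u s x - c)\<^sup>2 \<partial>lebesgue_on S) has_real_derivative
            2 * (\<integral>x. (u t x - c) * D x \<partial>lebesgue_on S)) (at t within {0..})"
proof -
  define M where "M = lebesgue_on S"
  interpret finite_measure M
    unfolding M_def using fin by (rule finite_measure_lebesgue_on)
  define r where "r s = (\<lambda>x. (u s x - u t x) / (s - t) - D x)" for s
  define w where "w s = (\<lambda>x. u s x - c)" for s
  have D: "D \<in> L2 S" and lim: "((\<lambda>s. L2_norm S (r s)) \<longlongrightarrow> 0) (at t within {0..})"
    using der by (auto simp: has_L2_time_derivative_def r_def)
  have rL2: "r s \<in> L2 S" if "0 \<le> s" for s
    unfolding r_def using u[OF that] u[OF t] D by (rule L2_difference_quotient_remainder)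
  have wL2: "w s \<in> L2 S" if "0 \<le> s" for s
    using square_integrable_diff[OF _ square_integrable_const] u[OF that]
    by (simp add: mem_L2_iff M_def w_def)
  have mult: "integrable M (\<lambda>x. f x * g x)" if "f \<in> L2 S" "g \<in> L2 S" for f g
    using that integrable_mult_square_integrable by (simp add: mem_L2_iff M_def)
  have sq: "integrable M (\<lambda>x. (f x)\<^sup>2)" if "f \<in> L2 S" for f
    using mult[OF that that] by (simp add: power2_eq_square)
  have Dr: "(\<lambda>x. D x + r s x) \<in> L2 S" if "0 \<le> s" for s
    using square_integrable_add D rL2[OF that] by (simp add: mem_L2_iff)
  define \<epsilon> where "\<epsilon> s = 2 * (\<integral>x. w t x * r s x \<partial>M) + (s - t) * (\<integral>x. (D x + r s x)\<^sup>2 \<partial>M)" for s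
  have "(\<epsilon> \<longlongrightarrow> 0) (at t within {0..})"
  proof (rule Lim_null_comparison)
    show "((\<lambda>s. 2 * (L2_norm S (w t) * L2_norm S (r s))
            + \<bar>s - t\<bar> * (2 * (L2_norm S D)\<^sup>2 + 2 * (L2_norm S (r s))\<^sup>2)) \<longlongrightarrow> 0) (at t within {0..})"
      by (rule tendsto_eq_intros lim refl | simp)+
    have "\<bar>\<epsilon> s\<bar> \<le> 2 * (L2_norm S (w t) * L2_norm S (r s))
            + \<bar>s - t\<bar> * (2 * (L2_norm S D)\<^sup>2 + 2 * (L2_norm S (r s))\<^sup>2)" if s: "0 \<le> s" for s
    proof -
      have "(\<integral>x. (D x + r s x)\<^sup>2 \<partial>M) \<le> (\<integral>x. 2 * (D x)\<^sup>2 + 2 * (r s x)\<^sup>2 \<partial>M)"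
      proof (rule integral_mono[OF sq[OF Dr[OF s]]])
        fix x
        have "0 \<le> (D x - r s x)\<^sup>2" by simp
        then show "(D x + r s x)\<^sup>2 \<le> 2 * (D x)\<^sup>2 + 2 * (r s x)\<^sup>2"
          unfolding power2_sum power2_diff by linarith
      qed (use sq[OF D] sq[OF rL2[OF s]] in auto)
      also have "\<dots> = 2 * (L2_norm S D)\<^sup>2 + 2 * (L2_norm S (r s))\<^sup>2"
        using sq[OF D] sq[OF rL2[OF s]] by (simp add: L2_norm_sq flip: M_def)
      finally have "\<bar>(s - t) * (\<integral>x. (D x + r s x)\<^sup>2 \<partial>M)\<bar>
          \<le> \<bar>s - t\<bar> * (2 * (L2_norm S D)\<^sup>2 + 2 * (L2_norm S (r s))\<^sup>2)"
        unfolding abs_mult by (intro mult_left_mono) auto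
      moreover have "\<bar>\<integral>x. w t x * r s x \<partial>M\<bar> \<le> L2_norm S (w t) * L2_norm S (r s)"
        unfolding M_def by (rule abs_integral_mult_le_L2_norm[OF wL2[OF t] rL2[OF s]])
      ultimately show ?thesis unfolding \<epsilon>_def by linarith
    qed
    then show "\<forall>\<^sub>F s in at t within {0..}. norm (\<epsilon> s) \<le> 2 * (L2_norm S (w t) * L2_norm S (r s))
            + \<bar>s - t\<bar> * (2 * (L2_norm S D)\<^sup>2 + 2 * (L2_norm S (r s))\<^sup>2)"
      by (auto simp: eventually_at_filter)
  qed
  then have "((\<lambda>s. 2 * (\<integral>x. w t x * D x \<partial>M) + \<epsilon> s) \<longlongrightarrow> 2 * (\<integral>x. w t x * D x \<partial>M)) (at t within {0..})"
    by (auto intro: tendsto_eq_intros)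
  moreover have "\<forall>\<^sub>F s in at t within {0..}. 2 * (\<integral>x. w t x * D x \<partial>M) + \<epsilon> s
      = ((\<integral>x. (w s x)\<^sup>2 \<partial>M) - (\<integral>x. (w t x)\<^sup>2 \<partial>M)) / (s - t)"
  proof -
    have "2 * (\<integral>x. w t x * D x \<partial>M) + \<epsilon> s = ((\<integral>x. (w s x)\<^sup>2 \<partial>M) - (\<integral>x. (w t x)\<^sup>2 \<partial>M)) / (s - t)"
      if s: "s \<ge> 0" "s \<noteq> t" for s
    proof -
      have "((\<integral>x. (w s x)\<^sup>2 \<partial>M) - (\<integral>x. (w t x)\<^sup>2 \<partial>M)) / (s - t)
          = (\<integral>x. ((w s x)\<^sup>2 - (w t x)\<^sup>2) / (s - t) \<partial>M)"
        using sq[OF wL2[OF s(1)]] sq[OF wL2[OF t]] by simp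
      also have "\<dots> = (\<integral>x. 2 * (w t x * D x) + 2 * (w t x * r s x) + (s - t) * (D x + r s x)\<^sup>2 \<partial>M)"
      proof (rule Bochner_Integration.integral_cong[OF refl])
        fix x
        have ws: "w s x = w t x + (s - t) * (D x + r s x)"
          using s(2) by (simp add: w_def r_def field_simps)
        have "(w s x)\<^sup>2 - (w t x)\<^sup>2
            = (s - t) * (2 * (w t x * D x) + 2 * (w t x * r s x) + (s - t) * (D x + r s x)\<^sup>2)"
          unfolding ws by (simp add: power2_eq_square algebra_simps)
        then show "((w s x)\<^sup>2 - (w t x)\<^sup>2) / (s - t)
            = 2 * (w t x * D x) + 2 * (w t x * r s x) + (s - t) * (D x + r s x)\<^sup>2"
          using s(2) by simp
      qed
      also have "\<dots> = 2 * (\<integral>x. w t x * D x \<partial>M) + \<epsilon> s"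
        using mult[OF wL2[OF t] D] mult[OF wL2[OF t] rL2[OF s(1)]] sq[OF Dr[OF s(1)]]
        by (simp add: \<epsilon>_def)
      finally show ?thesis by simp
    qed
    then show ?thesis by (auto simp: eventually_at_filter)
  qed
  ultimately have "((\<lambda>s. \<integral>x. (w s x)\<^sup>2 \<partial>M) has_real_derivative 2 * (\<integral>x. w t x * D x \<partial>M)) (at t within {0..})"
    unfolding has_field_derivative_iff by (rule Lim_transform_eventually)
  then show ?thesis by (simp add: w_def M_def)
qed

section \<open>A differential inequality\<close>

text \<open>
  The function \<open>e\<^sup>a\<^sup>t \<phi>(t) + P e\<^sup>-\<^sup>t\<close> is nonincreasing: its derivative is at most
  \<open>P e\<^sup>(\<^sup>a\<^sup>-\<^sup>2\<^sup>)\<^sup>t - P e\<^sup>-\<^sup>t\<close>, which is nonpositive because \<open>a \<le> 1\<close>.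
\<close>

lemma exponential_decay_of_differential_inequality:
  fixes \<phi> \<phi>' :: "real \<Rightarrow> real"
  assumes der: "\<And>t. 0 \<le> t \<Longrightarrow> (\<phi> has_real_derivative \<phi>' t) (at t within {0..})"
    and le: "\<And>t. 0 \<le> t \<Longrightarrow> \<phi>' t \<le> - a * \<phi> t + P * exp (- 2 * t)"
    and "a \<le> 1" "0 \<le> P" "0 \<le> t"
  shows "\<phi> t \<le> (\<phi> 0 + P) * exp (- a * t)"
proof -
  define g where "g s = exp (a * s) * \<phi> s + P * exp (- s)" for s
  have g_der: "(g has_real_derivative exp (a * s) * (a * \<phi> s + \<phi>' s) - P * exp (- s)) (at s within {0..})"
    if "0 \<le> s" for s
    unfolding g_def by (rule derivative_eq_intros der that refl | simp add: algebra_simps)+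
  have "g t \<le> g 0"
  proof (rule DERIV_nonpos_imp_decreasing_open[OF \<open>0 \<le> t\<close>])
    show "continuous_on {0..t} g"
      by (rule continuous_on_subset[of "{0..}"])
        (use g_der in \<open>auto simp: continuous_on_eq_continuous_within intro!: DERIV_continuous\<close>)
    fix s :: real assume s: "0 < s" "s < t"
    have "exp (a * s) * (a * \<phi> s + \<phi>' s) \<le> exp (a * s) * (P * exp (- 2 * s))"
      using le[of s] s by (intro mult_left_mono) auto
    also have "\<dots> = P * exp (a * s - 2 * s)" by (simp add: exp_diff exp_minus field_simps)
    also have "\<dots> \<le> P * exp (- s)"
      using mult_right_mono[OF \<open>a \<le> 1\<close>, of s] s \<open>0 \<le> P\<close> by (intro mult_left_mono) auto
    finally have "exp (a * s) * (a * \<phi> s + \<phi>' s) - P * exp (- s) \<le> 0" by simp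
    moreover have "at s within {0..} = at s"
      using s by (intro at_within_interior) auto
    ultimately show "\<exists>y. (g has_real_derivative y) (at s) \<and> y \<le> 0"
      using g_der[of s] s by auto
  qed
  then have "exp (a * t) * \<phi> t \<le> \<phi> 0 + P"
    using mult_nonneg_nonneg[OF \<open>0 \<le> P\<close>, of "exp (- t)"] by (simp add: g_def)
  then show ?thesis by (simp add: exp_minus field_simps)
qed

section \<open>Decay for symmetric nonlocal evolutions\<close>

text \<open>
  The energy estimate.  All constants are expressed through \<open>\<mu>\<close>, \<open>\<kappa>\<close> and the measure of
  \<open>\<Omega>\<close>, so that the bound is uniform over any family of kernels that share them.
\<close>

lemma nonlocal_evolution_decay:
  fixes \<Omega> :: "'a::euclidean_space set" and z :: "real \<Rightarrow> 'a \<Rightarrow> real"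
  assumes \<Omega>: "\<Omega> \<in> lmeasurable" and m: "0 < measure lebesgue \<Omega>"
    and K: "bounded_kernel (lebesgue_on \<Omega>) K" and sym: "\<And>x y. K x y = K y x"
    and "0 < \<mu>"
    and Poincare: "\<And>u. square_integrable (lebesgue_on \<Omega>) u \<Longrightarrow>
      2 * \<mu> * ((\<integral>x. (u x)\<^sup>2 \<partial>lebesgue_on \<Omega>) - (\<integral>x. u x \<partial>lebesgue_on \<Omega>)\<^sup>2 / measure lebesgue \<Omega>)
        \<le> dirichlet_form (lebesgue_on \<Omega>) K u"
    and k: "square_integrable (lebesgue_on \<Omega>) k"
    and k_mass: "(\<integral>x. k x \<partial>lebesgue_on \<Omega>) = 1"
    and k_sq: "(\<integral>x. (k x)\<^sup>2 \<partial>lebesgue_on \<Omega>) \<le> \<kappa>"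
    and z: "\<And>t. 0 \<le> t \<Longrightarrow> z t \<in> L2 \<Omega>"
    and z0: "AE x in lebesgue_on \<Omega>. z 0 x = 0"
    and der: "\<And>t. 0 \<le> t \<Longrightarrow> has_L2_time_derivative \<Omega> z (D t) t"
    and D: "\<And>t x. 0 \<le> t \<Longrightarrow> x \<in> \<Omega> \<Longrightarrow>
      D t x = (\<integral>y. K x y * (z t y - z t x) \<partial>lebesgue_on \<Omega>) + exp (- t) * k x"
    and t: "0 \<le> t"
  shows "(L2_norm \<Omega> (\<lambda>x. z t x - 1 / measure lebesgue \<Omega>))\<^sup>2
    \<le> (1 / measure lebesgue \<Omega> + (2 * \<mu> / measure lebesgue \<Omega> + \<kappa> / \<mu>)) * exp (- min \<mu> 1 * t)"
proof -
  define M where "M = lebesgue_on \<Omega>"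
  define m where "m = measure lebesgue \<Omega>"
  interpret finite_measure M
    unfolding M_def using \<Omega> by (rule finite_measure_lebesgue_on)
  have "0 < m" using m by (simp add: m_def)
  have sp: "space M = \<Omega>" by (simp add: M_def)
  have meas: "measure M (space M) = m"
    unfolding m_def sp M_def using \<Omega> by (subst measure_restrict_space) auto
  note K' = K[folded M_def] and k' = k[folded M_def]
  have zsq: "square_integrable M (z t)" if "0 \<le> t" for t
    using z[OF that] by (simp add: mem_L2_iff M_def)
  note zint = square_integrable_imp_integrable[OF zsq]
  note kint = square_integrable_imp_integrable[OF k']
  note one = square_integrable_const[of 1]
  have z0_meas[measurable]: "z 0 \<in> borel_measurable M"
    using zsq[of 0] by (simp add: square_integrable_def)
  have D_int: "(\<integral>x. v x * D t x \<partial>M)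
      = (\<integral>x. v x * (\<integral>y. K x y * (z t y - z t x) \<partial>M) \<partial>M) + exp (- t) * (\<integral>x. v x * k x \<partial>M)"
    if "0 \<le> t" "square_integrable M v" for t v
  proof -
    have "(\<integral>x. v x * D t x \<partial>M)
        = (\<integral>x. v x * (\<integral>y. K x y * (z t y - z t x) \<partial>M) + exp (- t) * (v x * k x) \<partial>M)"
      using D[OF that(1)] by (intro Bochner_Integration.integral_cong) (auto simp: sp M_def algebra_simps)
    then show ?thesis
      using integrable_nonlocal_operator[OF K' zsq[OF that(1)] that(2)]
        integrable_mult_square_integrable[OF that(2) k'] by simp
  qed
  \<comment> \<open>The operator conserves mass and the source has mass \<open>exp (- t)\<close>.\<close>
  have mass: "(\<integral>x. z t x \<partial>M) = 1 - exp (- t)" if "0 \<le> t" for t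
  proof -
    define h where "h t = (\<integral>x. z t x \<partial>M) + exp (- t)" for t
    have "(h has_real_derivative 0) (at s within {0..})" if "s \<in> {0..}" for s
    proof -
      have s: "0 \<le> s" using that by simp
      have "(\<integral>x. D s x \<partial>M) = exp (- s)"
        using D_int[OF s one] integral_nonlocal_operator_eq_0[OF K' sym zsq[OF s]] k_mass
        by (simp add: M_def)
      then show ?thesis
        unfolding h_def using has_real_derivative_integral_L2[OF \<Omega> z der[OF s] s, folded M_def]
        by (auto intro!: derivative_eq_intros)
    qed
    then obtain c where c: "\<And>s. s \<in> {0..} \<Longrightarrow> h s = c"
      using has_field_derivative_zero_constant[of "{0..}" h] by (auto simp: convex_real_interval)
    have "(\<integral>x. z 0 x \<partial>M) = 0"
      using z0 unfolding M_def by (rule integral_eq_zero_AE)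
    then have "h 0 = 1" by (simp add: h_def)
    then have "h t = 1" using c[of 0] c[of t] that by simp
    then show ?thesis by (simp add: h_def)
  qed
  define w where "w t = (\<lambda>x. z t x - 1 / m)" for t
  define \<phi> where "\<phi> t = (\<integral>x. (w t x)\<^sup>2 \<partial>M)" for t
  have wsq: "square_integrable M (w t)" if "0 \<le> t" for t
    unfolding w_def by (intro square_integrable_diff zsq that square_integrable_const)
  have "\<phi> t \<le> (\<phi> 0 + (2 * \<mu> / m + \<kappa> / \<mu>)) * exp (- min \<mu> 1 * t)"
  proof (rule exponential_decay_of_differential_inequality)
    have "0 \<le> \<kappa>" using k_sq by (rule order_trans[rotated]) simp
    then show "0 \<le> 2 * \<mu> / m + \<kappa> / \<mu>" using \<open>0 < m\<close> \<open>0 < \<mu>\<close> by simp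
    fix t :: real assume t: "0 \<le> t"
    show "(\<phi> has_real_derivative 2 * (\<integral>x. w t x * D t x \<partial>M)) (at t within {0..})"
      unfolding \<phi>_def w_def M_def
      by (rule has_real_derivative_integral_square_L2[OF \<Omega> z der[OF t] t])
    have w_mass: "(\<integral>x. w t x \<partial>M) = - exp (- t)"
      using zint[OF t] mass[OF t] \<open>0 < m\<close> by (simp add: w_def meas)
    have "2 * (\<integral>x. w t x * (\<integral>y. K x y * (z t y - z t x) \<partial>M) \<partial>M) = - dirichlet_form M K (w t)"
      using integral_nonlocal_operator_energy[OF K' sym wsq[OF t]] by (simp add: w_def)
    \<comment> \<open>The Poincare inequality, whose mean term is known exactly from the mass.\<close>
    moreover have "2 * \<mu> * (\<phi> t - exp (- 2 * t) / m) \<le> dirichlet_form M K (w t)"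
    proof -
      have "(exp (- t))\<^sup>2 = exp (- 2 * t)" by (simp flip: exp_double)
      then show ?thesis
        using Poincare[folded M_def m_def, OF wsq[OF t]] by (simp add: w_mass \<phi>_def)
    qed
    moreover have "2 * (exp (- t) * (\<integral>x. w t x * k x \<partial>M)) \<le> \<mu> * \<phi> t + \<kappa> / \<mu> * exp (- 2 * t)"
    proof -
      \<comment> \<open>Young's inequality with weight \<open>\<mu>\<close>, so that half of the damping \<open>2 \<mu> \<phi>\<close> survives.\<close>
      have wk: "integrable M (\<lambda>x. w t x * k x)"
        by (rule integrable_mult_square_integrable[OF wsq[OF t] k'])
      have ww: "integrable M (\<lambda>x. (w t x)\<^sup>2)" and kk: "integrable M (\<lambda>x. (k x)\<^sup>2)"
        using wsq[OF t] k' by (auto simp: square_integrable_def)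
      have "2 * (exp (- t) * (\<integral>x. w t x * k x \<partial>M)) = (\<integral>x. 2 * exp (- t) * (w t x * k x) \<partial>M)"
        by simp
      also have "\<dots> \<le> (\<integral>x. \<mu> * (w t x)\<^sup>2 + exp (- 2 * t) / \<mu> * (k x)\<^sup>2 \<partial>M)"
      proof (rule integral_mono)
        fix x
        have "0 \<le> (\<mu> * w t x - exp (- t) * k x)\<^sup>2 / \<mu>" using \<open>0 < \<mu>\<close> by simp
        also have "\<dots> = \<mu> * (w t x)\<^sup>2 + (exp (- t))\<^sup>2 / \<mu> * (k x)\<^sup>2 - 2 * exp (- t) * (w t x * k x)"
          using \<open>0 < \<mu>\<close> by (simp add: field_simps power2_eq_square)
        also have "(exp (- t))\<^sup>2 = exp (- 2 * t)" by (simp flip: exp_double)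
        finally show "2 * exp (- t) * (w t x * k x) \<le> \<mu> * (w t x)\<^sup>2 + exp (- 2 * t) / \<mu> * (k x)\<^sup>2"
          by simp
      qed (use wk ww kk in auto)
      also have "\<dots> = \<mu> * \<phi> t + exp (- 2 * t) / \<mu> * (\<integral>x. (k x)\<^sup>2 \<partial>M)"
        using ww kk by (simp add: \<phi>_def)
      also have "\<dots> \<le> \<mu> * \<phi> t + exp (- 2 * t) / \<mu> * \<kappa>"
        using k_sq \<open>0 < \<mu>\<close> by (intro add_left_mono mult_left_mono) (auto simp: M_def)
      finally show ?thesis by (simp add: mult.commute)
    qed
    ultimately have "2 * (\<integral>x. w t x * D t x \<partial>M)
        \<le> - \<mu> * \<phi> t + (2 * \<mu> / m + \<kappa> / \<mu>) * exp (- 2 * t)"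
      unfolding D_int[OF t wsq[OF t]] by (simp add: algebra_simps)
    moreover have "min \<mu> 1 * \<phi> t \<le> \<mu> * \<phi> t"
      by (intro mult_right_mono) (auto simp: \<phi>_def)
    ultimately show "2 * (\<integral>x. w t x * D t x \<partial>M)
        \<le> - min \<mu> 1 * \<phi> t + (2 * \<mu> / m + \<kappa> / \<mu>) * exp (- 2 * t)"
      by linarith
  qed (use t in auto)
  moreover have "\<phi> 0 = 1 / m"
  proof -
    have "\<phi> 0 = (\<integral>x. (1 / m)\<^sup>2 \<partial>M)"
      unfolding \<phi>_def
    proof (rule integral_cong_AE)
      show "AE x in M. (w 0 x)\<^sup>2 = (1 / m)\<^sup>2"
        using z0[folded M_def] by eventually_elim (simp add: w_def)
    qed (auto simp: w_def)
    then show ?thesis using \<open>0 < m\<close> by (simp add: meas power2_eq_square)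
  qed
  ultimately show ?thesis
    by (simp add: L2_norm_sq \<phi>_def w_def flip: M_def m_def)
qed

section \<open>The coupled kernel\<close>

text \<open>
  On the compact diagonal the kernel has a positive minimum, and by uniform continuity it stays
  above half of that minimum in a strip of uniform width around the diagonal.
\<close>

lemma admissible_kernel_lower_bound:
  assumes V: "admissible_kernel V" and S: "compact S"
  shows "\<exists>c>0. \<exists>\<delta>>0. \<forall>x\<in>S. \<forall>y\<in>S. dist x y < \<delta> \<longrightarrow> c \<le> V x y"
proof (cases "S = {}")
  case False
  have cont: "continuous_on UNIV (\<lambda>(x, y). V x y)" and pos: "\<And>x. 0 < V x x"
    using V by (auto simp: admissible_kernel_def)
  have "continuous_on S (\<lambda>x. V x x)"
    using continuous_on_compose2[OF cont continuous_on_Pair[OF continuous_on_id continuous_on_id] subset_UNIV]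
    by simp
  have "\<exists>x\<in>S. \<forall>y\<in>S. V x x \<le> V y y"
    by (rule continuous_attains_inf) fact+
  then obtain x0 where x0: "\<forall>x\<in>S. V x0 x0 \<le> V x x" by blast
  have "uniformly_continuous_on (S \<times> S) (\<lambda>(x, y). V x y)"
    using compact_uniformly_continuous[OF continuous_on_subset[OF cont subset_UNIV] compact_Times[OF S S]] .
  from this[unfolded uniformly_continuous_on_def, THEN spec, THEN mp, OF half_gt_zero[OF pos[of x0]]]
  obtain \<delta> where "\<delta> > 0"
    and \<delta>: "\<forall>p\<in>S \<times> S. \<forall>q\<in>S \<times> S. dist q p < \<delta> \<longrightarrow>
      dist (case q of (x, y) \<Rightarrow> V x y) (case p of (x, y) \<Rightarrow> V x y) < V x0 x0 / 2"
    by blast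
  have "V x0 x0 / 2 \<le> V x y" if xy: "x \<in> S" "y \<in> S" "dist x y < \<delta>" for x y
  proof -
    have "dist (V x y) (V x x) < V x0 x0 / 2"
      using bspec[OF bspec[OF \<delta>, of "(x, x)"], of "(x, y)"] xy by (simp add: dist_Pair_Pair dist_commute)
    moreover have "V x0 x0 \<le> V x x" using x0 xy(1) by blast
    ultimately show ?thesis unfolding dist_real_def by linarith
  qed
  show ?thesis
  proof (intro exI conjI ballI impI)
    show "0 < V x0 x0 / 2" "0 < \<delta>" using pos \<open>\<delta> > 0\<close> by simp_all
  qed fact
next
  case True
  show ?thesis
  proof (intro exI conjI)
    show "0 < (1 :: real)" "0 < (1 :: real)" by simp_all
  qed (simp add: True)
qed

lemma bounded_kernel_admissible:
  assumes V: "admissible_kernel V" and S: "bounded S"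
  shows "bounded_kernel (lebesgue_on S) V"
proof -
  have cont: "continuous_on UNIV (\<lambda>(x, y). V x y)"
    using V by (auto simp: admissible_kernel_def)
  have "compact ((\<lambda>(x, y). V x y) ` (closure S \<times> closure S))"
    using S by (intro compact_continuous_image continuous_on_subset[OF cont] compact_Times)
      (auto simp: compact_closure)
  from compact_imp_bounded[OF this] obtain b
    where b: "\<forall>v \<in> (\<lambda>(x, y). V x y) ` (closure S \<times> closure S). norm v \<le> b"
    unfolding bounded_iff ..
  have "\<bar>V x y\<bar> \<le> b" if "x \<in> S" "y \<in> S" for x y
  proof -
    have "(x, y) \<in> closure S \<times> closure S" using that closure_subset by blast
    from bspec[OF b imageI[OF this]] show ?thesis by simp
  qed
  then show ?thesis
    unfolding bounded_kernel_def using continuous_kernel_measurable[OF cont, of S] by auto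
qed

definition coupled_kernel ::
  "'a set \<Rightarrow> 'a set \<Rightarrow> ('a \<Rightarrow> 'a \<Rightarrow> real) \<Rightarrow> ('a \<Rightarrow> 'a \<Rightarrow> real) \<Rightarrow> ('a \<Rightarrow> 'a \<Rightarrow> real) \<Rightarrow> 'a \<Rightarrow> 'a \<Rightarrow> real" where
  "coupled_kernel A B J G R x y =
     indicat_real A x * indicat_real A y * J x y + indicat_real B x * indicat_real B y * G x y
   + indicat_real A x * indicat_real B y * R x y + indicat_real B x * indicat_real A y * R x y"

lemma coupled_kernel_cases:
  assumes "x \<in> A \<union> B" "y \<in> A \<union> B" "A \<inter> B = {}"
  shows "coupled_kernel A B J G R x y \<in> {J x y, G x y, R x y}"
  using assms by (auto simp: coupled_kernel_def indicator_def)

text \<open>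
  The constants precede the quantification over the partition: this is the uniformity on which
  the independence of the decay rate from \<open>n\<close> rests.
\<close>

lemma coupled_kernel_lower_bound:
  assumes J: "admissible_kernel J" and G: "admissible_kernel G" and R: "admissible_kernel R"
    and S: "compact S"
  shows "\<exists>c>0. \<exists>\<delta>>0. \<forall>A B. A \<inter> B = {} \<longrightarrow> (\<forall>x \<in> S \<inter> (A \<union> B). \<forall>y \<in> S \<inter> (A \<union> B).
           dist x y < \<delta> \<longrightarrow> c \<le> coupled_kernel A B J G R x y)"
proof -
  from admissible_kernel_lower_bound[OF J S] obtain c1 \<delta>1 where 1: "c1 > 0" "\<delta>1 > 0"
    "\<forall>x\<in>S. \<forall>y\<in>S. dist x y < \<delta>1 \<longrightarrow> c1 \<le> J x y"
    by (elim exE conjE)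
  from admissible_kernel_lower_bound[OF G S] obtain c2 \<delta>2 where 2: "c2 > 0" "\<delta>2 > 0"
    "\<forall>x\<in>S. \<forall>y\<in>S. dist x y < \<delta>2 \<longrightarrow> c2 \<le> G x y"
    by (elim exE conjE)
  from admissible_kernel_lower_bound[OF R S] obtain c3 \<delta>3 where 3: "c3 > 0" "\<delta>3 > 0"
    "\<forall>x\<in>S. \<forall>y\<in>S. dist x y < \<delta>3 \<longrightarrow> c3 \<le> R x y"
    by (elim exE conjE)
  show ?thesis
  proof (intro exI conjI allI impI ballI)
    show "0 < min c1 (min c2 c3)" "0 < min \<delta>1 (min \<delta>2 \<delta>3)"
      using 1 2 3 by simp_all
    fix A B x y
    assume disj: "A \<inter> B = {}" and xy: "x \<in> S \<inter> (A \<union> B)" "y \<in> S \<inter> (A \<union> B)"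
      and d: "dist x y < min \<delta>1 (min \<delta>2 \<delta>3)"
    have "c1 \<le> J x y" "c2 \<le> G x y" "c3 \<le> R x y"
      using 1(3) 2(3) 3(3) xy d by auto
    then show "min c1 (min c2 c3) \<le> coupled_kernel A B J G R x y"
      using coupled_kernel_cases[of x A B y J G R] xy disj by auto
  qed
qed

lemma coupled_kernel_sym:
  assumes "\<And>x y. J x y = J y x" "\<And>x y. G x y = G y x" "\<And>x y. R x y = R y x"
  shows "coupled_kernel A B J G R x y = coupled_kernel A B J G R y x"
  using assms(1)[of x y] assms(2)[of x y] assms(3)[of x y] by (simp add: coupled_kernel_def)

lemma bounded_kernel_coupled:
  assumes "bounded_kernel M J" "bounded_kernel M G" "bounded_kernel M R"
    and "{x \<in> space M. x \<in> A} \<in> sets M" "{x \<in> space M. x \<in> B} \<in> sets M"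
  shows "bounded_kernel M (coupled_kernel A B J G R)"
proof -
  have "coupled_kernel A B J G R = (\<lambda>x y. indicat_real A x * indicat_real A y * J x y
      + indicat_real B x * indicat_real B y * G x y
      + indicat_real A x * indicat_real B y * R x y + indicat_real B x * indicat_real A y * R x y)"
    by (simp add: coupled_kernel_def fun_eq_iff)
  then show ?thesis
    by (simp only:) (intro bounded_kernel_add bounded_kernel_restrict assms)
qed

text \<open>
  Applied with \<open>f y = z y - z x\<close> this turns the evolution equation into one with a single
  kernel; applied with \<open>f = 1\<close> it turns the normalization at \<open>xbar\<close> into a statement on the mass
  of the source.
\<close>

lemma integral_coupled_kernel_row:
  assumes "bounded_kernel M J" "bounded_kernel M G" "bounded_kernel M R"
    and A: "{x \<in> space M. x \<in> A} \<in> sets M" and B: "{x \<in> space M. x \<in> B} \<in> sets M"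
    and x: "x \<in> space M" and f: "integrable M f"
  shows "(\<integral>y. coupled_kernel A B J G R x y * f y \<partial>M)
    = indicat_real A x * (\<integral>y. indicat_real A y * J x y * f y \<partial>M)
    + indicat_real B x * (\<integral>y. indicat_real B y * G x y * f y \<partial>M)
    + indicat_real A x * (\<integral>y. indicat_real B y * R x y * f y \<partial>M)
    + indicat_real B x * (\<integral>y. indicat_real A y * R x y * f y \<partial>M)"
proof -
  have int: "integrable M (\<lambda>y. indicat_real E y * V x y * f y)"
    if "bounded_kernel M V" "{x \<in> space M. x \<in> E} \<in> sets M" for E V
    using integrable_kernel_row[OF bounded_kernel_restrict[OF that(1) _ that(2), of UNIV] x f] by simp
  have "(\<integral>y. coupled_kernel A B J G R x y * f y \<partial>M)
    = (\<integral>y. indicat_real A x * (indicat_real A y * J x y * f y)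
      + indicat_real B x * (indicat_real B y * G x y * f y)
      + indicat_real A x * (indicat_real B y * R x y * f y)
      + indicat_real B x * (indicat_real A y * R x y * f y) \<partial>M)"
    by (intro Bochner_Integration.integral_cong) (auto simp: coupled_kernel_def algebra_simps)
  then show ?thesis
    using int[OF assms(1) A] int[OF assms(2) B] int[OF assms(3) A] int[OF assms(3) B] by simp
qed

section \<open>Exponential decay for the coupled evolutions\<close>

theorem theorem1p5:
  fixes \<Omega> :: "'a::euclidean_space set"
    and J G R :: "'a \<Rightarrow> 'a \<Rightarrow> real"
    and A B :: "nat \<Rightarrow> 'a set"
    and X :: "'a \<Rightarrow> real"
    and xbar :: 'a
    and z :: "nat \<Rightarrow> real \<Rightarrow> 'a \<Rightarrow> real"
  assumes "open \<Omega>" and "connected \<Omega>" and "bounded \<Omega>" and "\<Omega> \<noteq> {}"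
    and "admissible_kernel J" and "admissible_kernel G" and "admissible_kernel R"
    and "\<And>n. closure \<Omega> = A n \<union> B n" and "\<And>n. A n \<inter> B n = {}"
    and "\<And>n. open (B n)" and "\<And>n. lipschitz_boundary (B n)"
    and "weak_Linfty_limit (closure \<Omega>) (\<lambda>n. indicat_real (A n)) X"
    and "weak_Linfty_limit (closure \<Omega>) (\<lambda>n. indicat_real (B n)) (\<lambda>x. 1 - X x)"
    and "AE x in lebesgue_on (closure \<Omega>). 0 < X x \<and> X x < 1"
    and "xbar \<in> \<Omega>"
    and "\<And>n. indicat_real (A n) xbar * (\<integral>y. indicat_real (A n) y * J xbar y \<partial>lebesgue_on \<Omega>)
           + indicat_real (B n) xbar * (\<integral>y. indicat_real (B n) y * G xbar y \<partial>lebesgue_on \<Omega>)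
           + indicat_real (A n) xbar * (\<integral>y. indicat_real (B n) y * R xbar y \<partial>lebesgue_on \<Omega>)
           + indicat_real (B n) xbar * (\<integral>y. indicat_real (A n) y * R xbar y \<partial>lebesgue_on \<Omega>) = 1"
    and "\<And>n. evolution_solution \<Omega> (A n) (B n) J G R xbar (z n)"
  shows "\<exists>a > 0. \<exists>C > 0. \<forall>n. \<forall>\<^sub>F t in at_top.
           (L2_norm \<Omega> (\<lambda>x. z n t x - 1 / measure lebesgue \<Omega>))\<^sup>2 \<le> C * exp (- a * t)"
proof -
  define M where "M = lebesgue_on \<Omega>"
  define m where "m = measure lebesgue \<Omega>"
  have \<Omega>_meas: "\<Omega> \<in> lmeasurable"
    using assms(1,3) by (simp add: lmeasurable_open)
  have sp: "space M = \<Omega>" by (simp add: M_def)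
  interpret finite_measure M
    unfolding M_def using \<Omega>_meas by (rule finite_measure_lebesgue_on)
  have "0 < m"
    using open_not_negligible[OF assms(1,4)] \<Omega>_meas
    by (metis m_def measure_nonneg negligible_iff_measure order_less_le)
  have meas: "measure M (space M) = m"
    unfolding m_def sp M_def using \<Omega>_meas by (subst measure_restrict_space) auto
  have disj: "A n \<inter> B n = {}" and cover: "\<Omega> \<subseteq> A n \<union> B n" for n
    using assms(8,9) closure_subset by blast+
  have B_sets: "{x \<in> space M. x \<in> B n} \<in> sets M" for n
  proof -
    have "open (B n \<inter> \<Omega>)" using assms(1,10) by (intro open_Int)
    then have "B n \<inter> \<Omega> \<in> sets lebesgue" by (simp add: borel_open)
    moreover have "{x \<in> space M. x \<in> B n} = B n \<inter> \<Omega>" by (auto simp: sp)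
    moreover have "\<Omega> \<in> sets lebesgue" using \<Omega>_meas by auto
    ultimately show ?thesis by (simp add: M_def sets_restrict_space_iff)
  qed
  have A_sets: "{x \<in> space M. x \<in> A n} \<in> sets M" for n
  proof -
    have "{x \<in> space M. x \<in> A n} = space M - {x \<in> space M. x \<in> B n}"
      using cover[of n] disj[of n] by (auto simp: sp)
    then show ?thesis using B_sets by auto
  qed
  have V: "bounded_kernel M J" "bounded_kernel M G" "bounded_kernel M R"
    unfolding M_def using assms(3,5-7) by (auto intro: bounded_kernel_admissible)
  define K where "K n = coupled_kernel (A n) (B n) J G R" for n
  have K: "bounded_kernel M (K n)" for n
    unfolding K_def by (intro bounded_kernel_coupled V A_sets B_sets)
  have K_sym: "K n x y = K n y x" for n x y
    unfolding K_def using assms(5-7)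
    by (intro coupled_kernel_sym) (auto simp: admissible_kernel_def)
  have K_cases: "K n x y \<in> {J x y, G x y, R x y}" if "x \<in> \<Omega>" "y \<in> \<Omega>" for n x y
    unfolding K_def using that cover[of n] disj[of n] by (intro coupled_kernel_cases) auto

  from coupled_kernel_lower_bound[OF assms(5-7)] assms(3)
  obtain c \<delta> where "c > 0" "\<delta> > 0"
    and c_all: "\<forall>A B. A \<inter> B = {} \<longrightarrow> (\<forall>x \<in> closure \<Omega> \<inter> (A \<union> B). \<forall>y \<in> closure \<Omega> \<inter> (A \<union> B).
           dist x y < \<delta> \<longrightarrow> c \<le> coupled_kernel A B J G R x y)"
    by (metis compact_closure)
  have c: "c \<le> K n x y" if "x \<in> \<Omega>" "y \<in> \<Omega>" "dist x y < \<delta>" for n x y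
  proof -
    have "\<forall>x \<in> closure \<Omega> \<inter> (A n \<union> B n). \<forall>y \<in> closure \<Omega> \<inter> (A n \<union> B n).
           dist x y < \<delta> \<longrightarrow> c \<le> K n x y"
      unfolding K_def using c_all disj[of n] by simp
    moreover have "x \<in> closure \<Omega> \<inter> (A n \<union> B n)" "y \<in> closure \<Omega> \<inter> (A n \<union> B n)"
      using that closure_subset cover[of n] by auto
    ultimately show ?thesis using that(3) by simp
  qed
  have K_nonneg: "0 \<le> K n x y" if "x \<in> \<Omega>" "y \<in> \<Omega>" for n x y
    using K_cases[OF that, of n] assms(5-7) by (auto simp: admissible_kernel_def)

  define near :: "'a \<Rightarrow> 'a \<Rightarrow> real" where "near = (\<lambda>x y. if dist x y < \<delta> then 1 else 0)"
  obtain C0 where "C0 > 0" and C0: "\<And>u. square_integrable M u \<Longrightarrow>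
      m * (\<integral>x. (u x)\<^sup>2 \<partial>M) - (\<integral>x. u x \<partial>M)\<^sup>2 \<le> C0 * dirichlet_form M near u"
    using nonlocal_Poincare[OF assms(1-3) \<open>\<delta> > 0\<close>, folded M_def m_def near_def]
    by (elim exE conjE) simp
  \<comment> \<open>\<open>c\<close> converts the model kernel into a minorant of \<open>K n\<close>; \<open>m / 2\<close> matches the normalization in
    the energy estimate.\<close>
  define \<mu> where "\<mu> = c * m / (2 * C0)"
  have "\<mu> > 0" using \<open>c > 0\<close> \<open>m > 0\<close> \<open>C0 > 0\<close> by (simp add: \<mu>_def)
  have Poincare: "2 * \<mu> * ((\<integral>x. (u x)\<^sup>2 \<partial>M) - (\<integral>x. u x \<partial>M)\<^sup>2 / m) \<le> dirichlet_form M (K n) u"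
    if u: "square_integrable M u" for u n
  proof -
    have "2 * \<mu> * ((\<integral>x. (u x)\<^sup>2 \<partial>M) - (\<integral>x. u x \<partial>M)\<^sup>2 / m)
        = c * ((m * (\<integral>x. (u x)\<^sup>2 \<partial>M) - (\<integral>x. u x \<partial>M)\<^sup>2) / C0)"
      using \<open>m > 0\<close> \<open>C0 > 0\<close> by (simp add: \<mu>_def field_simps)
    also have "\<dots> \<le> c * dirichlet_form M near u"
      using C0[OF u] \<open>c > 0\<close> \<open>C0 > 0\<close>
      by (intro mult_left_mono) (auto simp: divide_le_eq mult.commute)
    also have "\<dots> = dirichlet_form M (\<lambda>x y. c * near x y) u"
      by (rule dirichlet_form_cmult[symmetric])
    also have "\<dots> \<le> dirichlet_form M (K n) u"
    proof (rule dirichlet_form_mono[OF _ K u])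
      show "bounded_kernel M (\<lambda>x y. c * near x y)"
        unfolding M_def near_def by (rule bounded_kernel_near)
      fix x y assume "x \<in> space M" "y \<in> space M"
      then show "c * near x y \<le> K n x y"
        using c[of x y n] K_nonneg[of x y n] \<open>c > 0\<close> by (auto simp: near_def sp)
    qed
    finally show ?thesis .
  qed

  obtain b where b: "\<And>n x y. x \<in> \<Omega> \<Longrightarrow> y \<in> \<Omega> \<Longrightarrow> \<bar>K n x y\<bar> \<le> b"
  proof -
    have "\<exists>b. \<forall>x\<in>\<Omega>. \<forall>y\<in>\<Omega>. \<bar>W x y\<bar> \<le> b" if "bounded_kernel M W" for W
      using that unfolding bounded_kernel_def sp by (rule conjunct2)
    from this[OF V(1)] this[OF V(2)] this[OF V(3)]
    obtain b1 b2 b3 where "\<forall>x\<in>\<Omega>. \<forall>y\<in>\<Omega>. \<bar>J x y\<bar> \<le> b1" "\<forall>x\<in>\<Omega>. \<forall>y\<in>\<Omega>. \<bar>G x y\<bar> \<le> b2"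
      "\<forall>x\<in>\<Omega>. \<forall>y\<in>\<Omega>. \<bar>R x y\<bar> \<le> b3"
      by (elim exE)
    then have "\<bar>K n x y\<bar> \<le> max b1 (max b2 b3)" if "x \<in> \<Omega>" "y \<in> \<Omega>" for n x y
      using K_cases[OF that, of n] that by (auto simp: le_max_iff_disj)
    then show ?thesis by (rule that)
  qed
  have k_L2: "square_integrable M (K n xbar)" and k_sq: "(\<integral>x. (K n xbar x)\<^sup>2 \<partial>M) \<le> b\<^sup>2 * m"
    and k_mass: "(\<integral>x. K n xbar x \<partial>M) = 1" for n
  proof -
    have xbar: "xbar \<in> space M" using assms(15) by (simp add: sp)
    have one: "integrable M (\<lambda>x. 1 :: real)" by simp
    have k: "integrable M (K n xbar)"
      using integrable_kernel_row[OF K xbar one] by simp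
    have kk: "integrable M (\<lambda>x. (K n xbar x)\<^sup>2)"
      using integrable_kernel_row[OF K xbar k] by (simp add: power2_eq_square)
    then show "square_integrable M (K n xbar)"
      using k by (simp add: square_integrable_def)
    have "(\<integral>x. (K n xbar x)\<^sup>2 \<partial>M) \<le> (\<integral>x. b\<^sup>2 \<partial>M)"
    proof (rule integral_mono[OF kk])
      fix x assume "x \<in> space M"
      then have "\<bar>K n xbar x\<bar> \<le> \<bar>b\<bar>" using b[of xbar x n] assms(15) by (auto simp: sp)
      then show "(K n xbar x)\<^sup>2 \<le> b\<^sup>2" by (simp add: abs_le_square_iff)
    qed simp
    then show "(\<integral>x. (K n xbar x)\<^sup>2 \<partial>M) \<le> b\<^sup>2 * m" by (simp add: meas mult.commute)
    show "(\<integral>x. K n xbar x \<partial>M) = 1"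
      using integral_coupled_kernel_row[OF V A_sets B_sets xbar one, of n n] assms(16)[of n]
      by (simp add: K_def flip: M_def)
  qed
  define C where "C = 1 / m + (2 * \<mu> / m + b\<^sup>2 * m / \<mu>)"
  have "(L2_norm \<Omega> (\<lambda>x. z n t x - 1 / m))\<^sup>2 \<le> C * exp (- min \<mu> 1 * t)" if t: "0 \<le> t" for n t
    unfolding C_def m_def
  proof (rule nonlocal_evolution_decay[where K = "K n" and k = "K n xbar"
        and D = "evolution_rhs \<Omega> (A n) (B n) J G R xbar (z n)"])
    note sol = assms(17)[of n, unfolded evolution_solution_def]
    show "\<Omega> \<in> lmeasurable" "0 < \<mu>" "0 \<le> t" "K n x y = K n y x" for x y
      by (fact \<Omega>_meas \<open>\<mu> > 0\<close> t K_sym)+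
    show "0 < measure lebesgue \<Omega>" using \<open>m > 0\<close> by (simp add: m_def)
    show "bounded_kernel (lebesgue_on \<Omega>) (K n)" "square_integrable (lebesgue_on \<Omega>) (K n xbar)"
      "(\<integral>x. K n xbar x \<partial>lebesgue_on \<Omega>) = 1"
      using K k_L2 k_mass by (simp_all add: M_def)
    show "(\<integral>x. (K n xbar x)\<^sup>2 \<partial>lebesgue_on \<Omega>) \<le> b\<^sup>2 * measure lebesgue \<Omega>"
      using k_sq by (simp add: M_def m_def)
    show "2 * \<mu> * ((\<integral>x. (u x)\<^sup>2 \<partial>lebesgue_on \<Omega>) - (\<integral>x. u x \<partial>lebesgue_on \<Omega>)\<^sup>2 / measure lebesgue \<Omega>)
        \<le> dirichlet_form (lebesgue_on \<Omega>) (K n) u" if "square_integrable (lebesgue_on \<Omega>) u" for u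
      using Poincare that by (simp add: M_def m_def)
    show "AE x in lebesgue_on \<Omega>. z n 0 x = 0" using sol by blast
    fix t :: real assume t: "0 \<le> t"
    show zL2: "z n t \<in> L2 \<Omega>" using sol t by blast
    show "has_L2_time_derivative \<Omega> (z n) (evolution_rhs \<Omega> (A n) (B n) J G R xbar (z n) t) t"
      using sol t by blast
    have zint: "integrable M (z n t)"
      using zL2 by (intro square_integrable_imp_integrable) (simp add: mem_L2_iff M_def)
    fix x assume x: "x \<in> \<Omega>"
    have f: "integrable M (\<lambda>y. z n t y - z n t x)" using zint by simp
    have x': "x \<in> space M" using x by (simp add: sp)
    show "evolution_rhs \<Omega> (A n) (B n) J G R xbar (z n) t x
        = (\<integral>y. K n x y * (z n t y - z n t x) \<partial>lebesgue_on \<Omega>) + exp (- t) * K n xbar x"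
      unfolding K_def M_def[symmetric] integral_coupled_kernel_row[OF V A_sets B_sets x' f]
      by (simp add: evolution_rhs_def coupled_kernel_def algebra_simps flip: M_def)
  qed
  then have "\<forall>n. \<forall>\<^sub>F t in at_top. (L2_norm \<Omega> (\<lambda>x. z n t x - 1 / m))\<^sup>2 \<le> C * exp (- min \<mu> 1 * t)"
    by (intro allI eventually_mono[OF eventually_ge_at_top[of 0]])
  moreover have "C > 0"
    unfolding C_def using \<open>m > 0\<close> \<open>\<mu> > 0\<close> by (intro add_pos_nonneg) auto
  moreover have "min \<mu> 1 > 0" using \<open>\<mu> > 0\<close> by simp
  ultimately show ?thesis unfolding m_def by blast
qed

end
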